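(* Let $H$ be a separable infinite-dimensional complex Hilbert space with orthonormal basis $E=(e_n)_{n\in\mathbb{N}}$. Then the closed convex hull of $\pi(\mathrm{FS}_{\mathbb{N}})$ in $B(H)$ with respect to the Arens–Mackey topology equals the set of doubly substochastic matrices, i.e. $\overline{\mathrm{co}}^{M}\,\pi(\mathrm{FS}_{\mathbb{N}})=\mathrm{DSS}$. Moreover, the set of extreme points of $\mathrm{DSS}$ is exactly the set of partial permutation matrices, i.e. $\mathrm{ext}(\mathrm{DSS})=\mathrm{PS}_{\mathbb{N}}$.
   Context: For $a\in B(H)$ write $a_{mk}=\langle ae_k,e_m\rangle$ for its matrix coefficients with respect to $E$. $\mathrm{S}_{\mathbb{N}}$ is the group of all bijections $\mathbb{N}\to\mathbb{N}$, and $\mathrm{FS}_{\mathbb{N}}=\{\rho\in \mathrm{S}_{\mathbb{N}}: \rho(n)=n \text{ for all but finitely many } n\}$. The standard representation $\pi:\mathrm{S}_{\mathbb{N}}\to B(H)$ is given by $\pi(\rho)e_n=e_{\rho(n)}$. $\mathrm{DSS}=\{a\in B(H): a_{mk}\ge 0,\ \sum_{k=1}^\infty a_{mk}\le 1,\ \sum_{k=1}^\infty a_{km}\le 1 \text{ for all } m,k\}$. $\mathrm{PS}_{\mathbb{N}}=\{a\in B(H): a_{mk}\in\{0,1\},\ \sum_k a_{mk}\le 1,\ \sum_k a_{km}\le 1\text{ for all } m,k\}$. The Arens–Mackey topology $M$ on $B(H)$ is the Mackey topology $\tau(B(H),B(H)_* )$ of the duality between $B(H)$ and its predual $B(H)_*$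 (the ultraweakly continuous functionals), i.e. uniform convergence on convex $\sigma(B(H)_*,B(H))$-compact subsets of $B(H)_*$. $\overline{\mathrm{co}}^{M}$ denotes the $M$-closure of the convex hull. *)

theory Defs
  imports "HOL-Analysis.Analysis"
begin

class scaleC =
  fixes scaleC :: "complex \<Rightarrow> 'a \<Rightarrow> 'a"  (infixr "*\<^sub>C" 75)

(* Complex Hilbert spaces. The inner product is linear in its first argument. The real vector
   space structure and the norm of the class banach are tied to the complex structure by the
   axioms scaleC_of_real and norm_eq_sqrt_cinner. *)
class chilbert_space = banach + scaleC +
  fixes cinner :: "'a \<Rightarrow> 'a \<Rightarrow> complex"
  assumes scaleC_add_right: "c *\<^sub>C (x + y) = c *\<^sub>C x + c *\<^sub>C y"
    and scaleC_add_left: "(c + d) *\<^sub>C x = c *\<^sub>C x + d *\<^sub>C x"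
    and scaleC_scaleC: "c *\<^sub>C d *\<^sub>C x = (c * d) *\<^sub>C x"
    and scaleC_of_real: "complex_of_real r *\<^sub>C x = r *\<^sub>R x"
    and cinner_commute: "cinner x y = cnj (cinner y x)"
    and cinner_add_left: "cinner (x + y) z = cinner x z + cinner y z"
    and cinner_scaleC_left: "cinner (c *\<^sub>C x) y = c * cinner x y"
    and cinner_self_nonneg: "0 \<le> Re (cinner x x)"
    and norm_eq_sqrt_cinner: "norm x = sqrt (Re (cinner x x))"

lemma scaleC_module: "module (scaleC :: complex \<Rightarrow> 'h \<Rightarrow> 'h :: chilbert_space)"
proof
  fix c d :: complex and x y :: 'h
  show "1 *\<^sub>C x = x"
    using scaleC_of_real [of 1 x] by simp
qed (simp_all add: scaleC_add_right scaleC_add_left scaleC_scaleC)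

lemma norm_scaleC:
  fixes x :: "'h :: chilbert_space"
  shows "norm (c *\<^sub>C x) = cmod c * norm x"
proof -
  have "cinner (c *\<^sub>C x) (c *\<^sub>C x) = c * cnj c * cinner x x"
    by (metis (no_types, lifting) cinner_commute cinner_scaleC_left complex_cnj_mult
        mult.assoc mult.commute)
  also have "\<dots> = complex_of_real ((cmod c)\<^sup>2) * cinner x x"
    by (simp only: complex_norm_square)
  finally have "Re (cinner (c *\<^sub>C x) (c *\<^sub>C x)) = (cmod c)\<^sup>2 * Re (cinner x x)"
    by simp
  then show ?thesis
    by (simp add: norm_eq_sqrt_cinner real_sqrt_mult)
qed

lemma bounded_linear_scaleC: "bounded_linear (\<lambda>x :: 'h :: chilbert_space. c *\<^sub>C x)"
proof (rule bounded_linear_intro [of _ "cmod c"])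
  fix r and x y :: 'h
  show "c *\<^sub>C (x + y) = c *\<^sub>C x + c *\<^sub>C y"
    by (rule scaleC_add_right)
  show "c *\<^sub>C r *\<^sub>R x = r *\<^sub>R c *\<^sub>C x"
    by (metis mult.commute scaleC_of_real scaleC_scaleC)
  show "norm (c *\<^sub>C x) \<le> norm x * cmod c"
    by (simp add: norm_scaleC)
qed

definition orthonormal_basis :: "(nat \<Rightarrow> 'h :: chilbert_space) \<Rightarrow> bool" where
  "orthonormal_basis e \<longleftrightarrow>
     (\<forall>m n. cinner (e m) (e n) = (if m = n then 1 else 0)) \<and>
     closure (module.span scaleC (range e)) = UNIV"

(* The type 'h \<Rightarrow>\<^sub>L 'h consists of the real-linear bounded operators; B(H) is its
   subspace of complex-linear ones. *)
definition BH :: "('h :: chilbert_space \<Rightarrow>\<^sub>L 'h) set" where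
  "BH = {a. \<forall>c x. blinfun_apply a (c *\<^sub>C x) = c *\<^sub>C blinfun_apply a x}"

lift_definition scaleC_op ::
    "complex \<Rightarrow> ('h :: chilbert_space \<Rightarrow>\<^sub>L 'h) \<Rightarrow> ('h \<Rightarrow>\<^sub>L 'h)"
  is "\<lambda>c a x. c *\<^sub>C a x"
  by (rule bounded_linear_compose [OF bounded_linear_scaleC])

definition mcoeff ::
    "(nat \<Rightarrow> 'h :: chilbert_space) \<Rightarrow> ('h \<Rightarrow>\<^sub>L 'h) \<Rightarrow> nat \<Rightarrow> nat \<Rightarrow> complex" where
  "mcoeff e a m k = cinner (blinfun_apply a (e k)) (e m)"

definition FS :: "(nat \<Rightarrow> nat) set" where
  "FS = {\<rho>. bij \<rho> \<and> finite {n. \<rho> n \<noteq> n}}"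

(* For an orthonormal basis e and a bijection \<rho> there is exactly one such operator. *)
definition std_rep ::
    "(nat \<Rightarrow> 'h :: chilbert_space) \<Rightarrow> (nat \<Rightarrow> nat) \<Rightarrow> ('h \<Rightarrow>\<^sub>L 'h)" where
  "std_rep e \<rho> = (THE a. a \<in> BH \<and> (\<forall>n. blinfun_apply a (e n) = e (\<rho> n)))"

(* Entries are nonnegative reals or 0/1 wherever this predicate is used, so Re loses nothing.
   Summability is explicit because suminf is unspecified for divergent series. *)
definition line_sums_le_1 :: "(nat \<Rightarrow> nat \<Rightarrow> complex) \<Rightarrow> bool" where
  "line_sums_le_1 A \<longleftrightarrow>
     (\<forall>m. summable (\<lambda>k. Re (A m k)) \<and> (\<Sum>k. Re (A m k)) \<le> 1 \<and>
          summable (\<lambda>k. Re (A k m)) \<and> (\<Sum>k. Re (A k m)) \<le> 1)"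

definition DSS :: "(nat \<Rightarrow> 'h :: chilbert_space) \<Rightarrow> ('h \<Rightarrow>\<^sub>L 'h) set" where
  "DSS e = {a \<in> BH. (\<forall>m k. mcoeff e a m k \<in> \<real>\<^sub>\<ge>\<^sub>0) \<and> line_sums_le_1 (mcoeff e a)}"

definition PS :: "(nat \<Rightarrow> 'h :: chilbert_space) \<Rightarrow> ('h \<Rightarrow>\<^sub>L 'h) set" where
  "PS e = {a \<in> BH. (\<forall>m k. mcoeff e a m k \<in> {0, 1}) \<and> line_sums_le_1 (mcoeff e a)}"

definition ultraweak_topology :: "('h :: chilbert_space \<Rightarrow>\<^sub>L 'h) topology" where
  "ultraweak_topology = topology_generated_by
     {{a \<in> BH. (\<Sum>n. cinner (blinfun_apply a (x n)) (y n)) \<in> U} | x y U.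
        summable (\<lambda>n :: nat. (norm (x n))\<^sup>2) \<and> summable (\<lambda>n :: nat. (norm (y n))\<^sup>2) \<and> open U}"

(* Functionals on a set V of vectors are represented by extensional functions, as in PiE:
   they take the value undefined outside V. *)
definition predual :: "(('h :: chilbert_space \<Rightarrow>\<^sub>L 'h) \<Rightarrow> complex) set" where
  "predual = {\<phi> \<in> extensional BH.
     (\<forall>a\<in>BH. \<forall>b\<in>BH. \<phi> (a + b) = \<phi> a + \<phi> b) \<and>
     (\<forall>a\<in>BH. \<forall>c. \<phi> (scaleC_op c a) = c * \<phi> a) \<and>
     continuous_map ultraweak_topology euclidean \<phi>}"

definition convex_functionals :: "'v set \<Rightarrow> ('v \<Rightarrow> complex) set \<Rightarrow> bool" where
  "convex_functionals V K \<longleftrightarrow>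
     (\<forall>f\<in>K. \<forall>g\<in>K. \<forall>u\<ge>0. \<forall>v\<ge>0. u + v = 1 \<longrightarrow>
        (\<lambda>x\<in>V. complex_of_real u * f x + complex_of_real v * g x) \<in> K)"

(* The weak topology \<sigma>(F, V) on a space F of functionals on V. *)
definition sigma_topology ::
    "('v \<Rightarrow> complex) set \<Rightarrow> 'v set \<Rightarrow> ('v \<Rightarrow> complex) topology" where
  "sigma_topology F V = subtopology (product_topology (\<lambda>_. euclidean) V) F"

(* The Mackey topology \<tau>(V, F): uniform convergence on the convex \<sigma>(F, V)-compact
   subsets of F. By compactness the supremum of the values cmod (f b - f a) over f in K is attained,
   so the sets below are the open balls of the corresponding seminorms. *)
definition mackey_topology :: "'v set \<Rightarrow> ('v \<Rightarrow> complex) set \<Rightarrow> 'v topology" where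
  "mackey_topology V F = topology_generated_by
     {{b \<in> V. \<forall>f\<in>K. cmod (f b - f a) < r} | a K r.
        a \<in> V \<and> K \<subseteq> F \<and> convex_functionals V K \<and> compactin (sigma_topology F V) K \<and> 0 < r}"

definition arens_mackey_topology :: "('h :: chilbert_space \<Rightarrow>\<^sub>L 'h) topology" where
  "arens_mackey_topology = mackey_topology BH predual"

end

theory Submission
  imports Defs
begin

text \<open>
  The matrix coefficients of an operator are functionals in the predual, so the doubly substochastic
  matrices are closed for the Arens--Mackey topology. Conversely, the leading \<open>N \<times> N\<close> block of a
  doubly substochastic matrix dilates to a doubly stochastic \<open>2N \<times> 2N\<close> matrix, which by Birkhoff's
  theorem is a convex combination of permutation matrices. This gives contractions \<open>c\<^sub>N\<close> in the convex
  hull of the finite permutations whose coefficients converge to those of \<open>a\<close>, hence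
  \<open>\<phi> c\<^sub>N \<longlonglongrightarrow> \<phi> a\<close> for every \<open>\<phi>\<close> in the predual. A minimax theorem turns this pointwise
  approximation into a uniform one on convex compact sets of functionals, at the price of passing to other
  elements of the convex hull; this replaces the Mackey--Arens theorem.

  For the extreme points, a matrix with an entry \<open>t\<close> strictly between 0 and 1 at \<open>(m, k)\<close> is split by
  conditioning the Birkhoff mixtures of its leading blocks on the value of the entry at \<open>(m, k)\<close> and
  passing to a limit.
\<close>

section \<open>Complex Hilbert spaces with an orthonormal basis\<close>

text \<open>A convex set has the same closure in all locally convex topologies with the same dual,
  but applying this requires knowing that \<open>predual\<close> is the whole dual of the Mackey
  topology. The minimax argument avoids that identification: on compact convex sets of functionals
  it exchanges "for each functional some element of the hull" with "one element of the hull for all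
  functionals". Convergence on the predual needs the norm bound as well as convergence of entries,
  since an ultraweak functional involves infinitely many vectors and entries alone do not control
  its tail.

  For extreme points, the finite method of perturbing fractional entries along a cycle breaks down:
  an alternating path of fractional entries can be infinite, with entries arbitrarily close to 0 or
  1, which leaves no admissible step size. Conditioning fixes the weights \<open>t\<close> and
  \<open>1 - t\<close> beforehand, so both pieces survive the limit. Mass may escape to infinity in
  that limit, which is harmless because line sums are only bounded above by 1.\<close>

interpretation scaleC: module "scaleC :: complex \<Rightarrow> 'h \<Rightarrow> 'h :: chilbert_space"
  by (rule scaleC_module)

lemma cinner_add_right: "cinner x (y + z) = cinner x y + cinner x z"
  by (metis cinner_add_left cinner_commute complex_cnj_add)

lemma cinner_scaleC_right: "cinner x (c *\<^sub>C y) = cnj c * cinner x y"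
  by (metis cinner_scaleC_left cinner_commute complex_cnj_mult)

lemma cinner_zero_left [simp]: "cinner 0 x = 0"
  using cinner_add_left [of 0 0 x] by simp

lemma cinner_zero_right [simp]: "cinner x 0 = 0"
  using cinner_add_right [of x 0 0] by simp

lemma cinner_minus_left: "cinner (- x) y = - cinner x y"
  using cinner_add_left [of "- x" x y] by (simp add: eq_neg_iff_add_eq_0)

lemma cinner_minus_right: "cinner x (- y) = - cinner x y"
  using cinner_add_right [of x "- y" y] by (simp add: eq_neg_iff_add_eq_0)

lemma cinner_diff_left: "cinner (x - y) z = cinner x z - cinner y z"
  using cinner_add_left [of x "- y" z] by (simp add: cinner_minus_left)

lemma cinner_diff_right: "cinner x (y - z) = cinner x y - cinner x z"
  using cinner_add_right [of x y "- z"] by (simp add: cinner_minus_right)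

lemma cinner_sum_left: "cinner (\<Sum>i\<in>I. f i) y = (\<Sum>i\<in>I. cinner (f i) y)"
  by (induction I rule: infinite_finite_induct) (simp_all add: cinner_add_left)

lemma cinner_sum_right: "cinner x (\<Sum>i\<in>I. f i) = (\<Sum>i\<in>I. cinner x (f i))"
  by (induction I rule: infinite_finite_induct) (simp_all add: cinner_add_right)

lemma cinner_scaleR_left: "cinner (r *\<^sub>R x) y = of_real r * cinner x y"
  by (metis cinner_scaleC_left scaleC_of_real)

lemma power2_norm_eq_cinner: "(norm x)\<^sup>2 = Re (cinner x x)"
  by (simp add: norm_eq_sqrt_cinner cinner_self_nonneg)

lemma cinner_self: "cinner x x = complex_of_real ((norm x)\<^sup>2)"
  using cinner_commute [of x x]
  by (simp add: complex_eq_iff power2_norm_eq_cinner)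

lemma norm_add_orthogonal:
  assumes "cinner x y = 0"
  shows "(norm (x + y))\<^sup>2 = (norm x)\<^sup>2 + (norm y)\<^sup>2"
proof -
  have "cinner y x = 0"
    using assms by (metis cinner_commute complex_cnj_zero)
  then show ?thesis
    using assms by (simp add: power2_norm_eq_cinner cinner_add_left cinner_add_right)
qed

lemma cinner_Cauchy_Schwarz: "cmod (cinner x y) \<le> norm x * norm y"
proof (cases "y = 0")
  case False
  define c where "c = cinner x y / complex_of_real ((norm y)\<^sup>2)"
  have ny: "norm y > 0"
    using False by simp
  have orth: "cinner (x - c *\<^sub>C y) (c *\<^sub>C y) = 0"
    using ny by (simp add: c_def cinner_diff_left cinner_scaleC_left cinner_scaleC_right cinner_self)
  have "(cmod c * norm y)\<^sup>2 \<le> (norm (x - c *\<^sub>C y + c *\<^sub>C y))\<^sup>2"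
    unfolding norm_add_orthogonal [OF orth] by (simp add: norm_scaleC)
  then have "cmod c * norm y \<le> norm x"
    by (simp add: power2_le_iff_abs_le)
  moreover have "cmod c * norm y = cmod (cinner x y) / norm y"
  proof -
    have "cmod c = cmod (cinner x y) / (norm y)\<^sup>2"
      by (simp add: c_def norm_divide norm_power)
    then show ?thesis
      using ny by (simp add: power2_eq_square)
  qed
  ultimately show ?thesis
    using ny by (simp add: field_simps)
qed simp

lemma bounded_linear_cinner_left: "bounded_linear (\<lambda>x. cinner x y)"
proof (rule bounded_linear_intro [of _ "norm y"])
  show "cinner (r *\<^sub>R x) y = r *\<^sub>R cinner x y" for r x
    by (simp add: cinner_scaleR_left scaleR_conv_of_real)
qed (simp_all add: cinner_add_left cinner_Cauchy_Schwarz)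

lemma BH_scaleC: "a \<in> BH \<Longrightarrow> blinfun_apply a (c *\<^sub>C x) = c *\<^sub>C blinfun_apply a x"
  by (simp add: BH_def)

section \<open>Fourier expansion and operators given by their matrices\<close>

context
  fixes e :: "nat \<Rightarrow> 'h :: chilbert_space"
  assumes onb: "orthonormal_basis e"
begin

lemma cinner_basis: "cinner (e m) (e n) = (if m = n then 1 else 0)"
  using onb by (simp add: orthonormal_basis_def)

lemma cinner_basis_sum:
  "finite F \<Longrightarrow> cinner (\<Sum>k\<in>F. c k *\<^sub>C e k) (e j) = (if j \<in> F then c j else 0)"
  by (simp add: cinner_sum_left cinner_scaleC_left cinner_basis if_distrib cong: if_cong)

lemma norm_basis_sum:
  assumes "finite F"
  shows "(norm (\<Sum>k\<in>F. c k *\<^sub>C e k))\<^sup>2 = (\<Sum>k\<in>F. (cmod (c k))\<^sup>2)"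
proof -
  have "cinner (\<Sum>k\<in>F. c k *\<^sub>C e k) (\<Sum>j\<in>F. c j *\<^sub>C e j)
      = (\<Sum>j\<in>F. cnj (c j) * (if j \<in> F then c j else 0))"
    by (simp only: cinner_sum_right cinner_scaleC_right cinner_basis_sum [OF assms])
  also have "\<dots> = (\<Sum>j\<in>F. complex_of_real ((cmod (c j))\<^sup>2))"
    by (intro sum.cong) (simp_all only: complex_norm_square mult.commute if_True)
  finally show ?thesis
    by (simp add: power2_norm_eq_cinner)
qed

lemma Bessel_eq:
  assumes "finite F"
  shows "(norm x)\<^sup>2 = (norm (x - (\<Sum>k\<in>F. cinner x (e k) *\<^sub>C e k)))\<^sup>2
           + (\<Sum>k\<in>F. (cmod (cinner x (e k)))\<^sup>2)"
proof -
  let ?s = "\<Sum>k\<in>F. cinner x (e k) *\<^sub>C e k"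
  have "cinner (x - ?s) (e j) = 0" if "j \<in> F" for j
    using that by (simp add: cinner_diff_left cinner_basis_sum assms)
  then have "cinner (x - ?s) ?s = 0"
    by (subst cinner_sum_right) (simp add: cinner_scaleC_right)
  from norm_add_orthogonal [OF this] show ?thesis
    by (simp add: norm_basis_sum assms)
qed

text \<open>Bessel's identity makes \<open>x - S n x\<close> at most as long as \<open>x\<close>,
  and on the span of the basis \<open>S n\<close> is eventually the identity. Density of the span
  carries the convergence to every vector.\<close>

lemma Fourier_sums: "(\<lambda>k. cinner x (e k) *\<^sub>C e k) sums x"
proof -
  define S where "S n x = (\<Sum>k<n. cinner x (e k) *\<^sub>C e k)" for n x
  have contr: "norm (x - S n x) \<le> norm x" for n x
  proof (rule power2_le_imp_le)
    have "0 \<le> (\<Sum>k<n. (cmod (cinner x (e k)))\<^sup>2)"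
      by (rule sum_nonneg) simp
    then show "(norm (x - S n x))\<^sup>2 \<le> (norm x)\<^sup>2"
      unfolding S_def using Bessel_eq [OF finite_lessThan, of x n] by linarith
  qed simp
  have S_diff: "S n (x - y) = S n x - S n y" for n x y
    by (simp add: S_def cinner_diff_left scaleC.scale_left_diff_distrib sum_subtractf)
  have span: "\<exists>N. \<forall>n\<ge>N. S n v = v" if "v \<in> scaleC.span (range e)" for v
    using that
  proof (induction rule: scaleC.span_induct_alt)
    case base
    then show ?case by (simp add: S_def)
  next
    case (step c x y)
    from step.hyps(1) obtain k where k: "x = e k"
      by blast
    from step.IH obtain N where N: "\<And>n. n \<ge> N \<Longrightarrow> S n y = y"
      by blast
    have "S n (c *\<^sub>C x + y) = c *\<^sub>C x + y" if "n \<ge> max N (Suc k)" for n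
    proof -
      have "S n (c *\<^sub>C x + y) = (\<Sum>j<n. (if j = k then c *\<^sub>C x else 0)) + S n y"
        unfolding S_def sum.distrib [symmetric]
        by (rule sum.cong)
          (auto simp: cinner_add_left cinner_scaleC_left k cinner_basis scaleC.scale_left_distrib)
      then show ?thesis
        using that N by auto
    qed
    then show ?case by blast
  qed
  have "(\<lambda>n. S n x) \<longlonglongrightarrow> x"
  proof (rule LIMSEQ_I)
    fix r :: real assume "r > 0"
    have "x \<in> closure (scaleC.span (range e))"
      using onb by (simp add: orthonormal_basis_def)
    then obtain v where v: "v \<in> scaleC.span (range e)" "norm (x - v) < r"
      using \<open>r > 0\<close> by (metis closure_approachable dist_commute dist_norm)
    obtain N where N: "\<And>n. n \<ge> N \<Longrightarrow> S n v = v"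
      using span [OF v(1)] by blast
    have "norm (S n x - x) < r" if "n \<ge> N" for n
    proof -
      have "x - S n x = (x - v) - S n (x - v)"
        using N [OF that] by (simp add: S_diff)
      then show ?thesis
        using contr [of "x - v" n] v(2) by (metis le_less_trans norm_minus_commute)
    qed
    then show "\<exists>N. \<forall>n\<ge>N. norm (S n x - x) < r" by blast
  qed
  then show ?thesis
    by (simp add: sums_def S_def)
qed

lemma Parseval: "(\<lambda>k. (cmod (cinner x (e k)))\<^sup>2) sums (norm x)\<^sup>2"
proof -
  have "(\<lambda>n. (norm (\<Sum>k<n. cinner x (e k) *\<^sub>C e k))\<^sup>2) \<longlonglongrightarrow> (norm x)\<^sup>2"
    using Fourier_sums [of x] by (intro tendsto_power tendsto_norm) (simp add: sums_def)
  then show ?thesis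
    by (simp add: sums_def norm_basis_sum)
qed

lemma Riesz_Fischer:
  assumes "summable (\<lambda>k. (cmod (c k))\<^sup>2)"
  shows "summable (\<lambda>k. c k *\<^sub>C e k)" and "cinner (\<Sum>k. c k *\<^sub>C e k) (e j) = c j"
proof -
  show summ: "summable (\<lambda>k. c k *\<^sub>C e k)"
    unfolding summable_Cauchy
  proof (intro allI impI)
    fix r :: real assume "r > 0"
    then obtain N where N: "\<And>m n. m \<ge> N \<Longrightarrow> norm (\<Sum>k=m..<n. (cmod (c k))\<^sup>2) < r\<^sup>2"
      using assms unfolding summable_Cauchy by (meson zero_less_power)
    have "norm (\<Sum>k=m..<n. c k *\<^sub>C e k) < r" if "m \<ge> N" for m n
    proof (rule power2_less_imp_less)
      show "(norm (\<Sum>k=m..<n. c k *\<^sub>C e k))\<^sup>2 < r\<^sup>2"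
        using N [OF that, of n] by (simp add: norm_basis_sum sum_nonneg)
    qed (use \<open>r > 0\<close> in simp)
    then show "\<exists>N. \<forall>m\<ge>N. \<forall>n. norm (\<Sum>k=m..<n. c k *\<^sub>C e k) < r" by blast
  qed
  have "(\<lambda>k. cinner (c k *\<^sub>C e k) (e j)) sums cinner (\<Sum>k. c k *\<^sub>C e k) (e j)"
    by (rule bounded_linear.sums [OF bounded_linear_cinner_left summable_sums [OF summ]])
  moreover have "(\<lambda>k. cinner (c k *\<^sub>C e k) (e j)) = (\<lambda>k. if k = j then c j else 0)"
    by (auto simp: cinner_scaleC_left cinner_basis)
  ultimately show "cinner (\<Sum>k. c k *\<^sub>C e k) (e j) = c j"
    using sums_single [of j "\<lambda>_. c j"] by (simp add: sums_unique2)
qed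

lemma basis_coeffs_eqI: "(\<And>k. cinner x (e k) = cinner y (e k)) \<Longrightarrow> x = y"
  using Fourier_sums [of x] Fourier_sums [of y] by (simp add: sums_unique2)

text \<open>Complex linearity enters here: a merely real-linear operator is not determined by its
  values on the basis vectors.\<close>

lemma BH_apply_sums:
  assumes "a \<in> BH"
  shows "(\<lambda>k. cinner x (e k) *\<^sub>C blinfun_apply a (e k)) sums blinfun_apply a x"
  using bounded_linear.sums [OF blinfun.bounded_linear_right [of a] Fourier_sums [of x]] assms
  by (simp add: BH_scaleC)

lemma BH_eqI:
  assumes "a \<in> BH" "b \<in> BH" "\<And>m k. mcoeff e a m k = mcoeff e b m k"
  shows "a = b"
proof (rule blinfun_eqI)
  fix x
  have "blinfun_apply a (e k) = blinfun_apply b (e k)" for k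
    using assms(3) by (intro basis_coeffs_eqI) (simp add: mcoeff_def)
  then show "blinfun_apply a x = blinfun_apply b x"
    using BH_apply_sums [OF assms(1), of x] BH_apply_sums [OF assms(2), of x]
    by (simp add: sums_unique2)
qed

text \<open>The Schur test: boundedness follows from the Cauchy--Schwarz inequality applied to each
  row with the weights \<open>B m k\<close>.\<close>

lemma substochastic_operator:
  fixes B :: "nat \<Rightarrow> nat \<Rightarrow> real"
  assumes nn: "\<And>m k. B m k \<ge> 0"
    and row: "\<And>m n. (\<Sum>k<n. B m k) \<le> 1"
    and col: "\<And>k n. (\<Sum>m<n. B m k) \<le> 1"
  obtains b where "b \<in> BH" "norm b \<le> 1" "\<And>m k. mcoeff e b m k = of_real (B m k)"
proof -
  define y where "y x m = (\<Sum>k. of_real (B m k) * cinner x (e k))" for x m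
  have Bs: "summable (B m)" for m
    using nn row by (intro summableI_nonneg_bounded [where x = 1]) auto
  have coeff_le: "cmod (cinner x (e k)) \<le> norm x" for x k
    using cinner_Cauchy_Schwarz [of x "e k"] cinner_basis [of k k]
    by (simp add: norm_eq_sqrt_cinner [of "e k"])
  have ys: "summable (\<lambda>k. of_real (B m k) * cinner x (e k))" for x m
  proof (rule summable_comparison_test')
    show "summable (\<lambda>k. B m k * norm x)"
      by (intro summable_mult2 Bs)
    show "norm (of_real (B m k) * cinner x (e k)) \<le> B m k * norm x" if "k \<ge> 0" for k
      using nn coeff_le by (simp add: norm_mult mult_left_mono)
  qed
  \<comment> \<open>Both indices are cut off, so the two sums can be interchanged freely. Letting
    \<open>n\<close> grow while \<open>M\<close> stays finite then bounds the coefficients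
    \<open>y x m\<close> themselves.\<close>
  have trunc: "(\<Sum>m<M. (cmod (\<Sum>k<n. of_real (B m k) * cinner x (e k)))\<^sup>2) \<le> (norm x)\<^sup>2"
    for M n x
  proof -
    let ?q = "\<lambda>k. cmod (cinner x (e k))"
    have "(cmod (\<Sum>k<n. of_real (B m k) * cinner x (e k)))\<^sup>2 \<le> (\<Sum>k<n. B m k * (?q k)\<^sup>2)" for m
    proof -
      have "cmod (\<Sum>k<n. of_real (B m k) * cinner x (e k)) \<le> (\<Sum>k<n. sqrt (B m k) * (sqrt (B m k) * ?q k))"
        by (rule order.trans [OF norm_sum])
          (simp add: norm_mult nn flip: mult.assoc)
      then have "(cmod (\<Sum>k<n. of_real (B m k) * cinner x (e k)))\<^sup>2
          \<le> (\<Sum>k<n. sqrt (B m k) * (sqrt (B m k) * ?q k))\<^sup>2"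
        by (rule power_mono) simp
      also have "\<dots> \<le> (\<Sum>k<n. (sqrt (B m k))\<^sup>2) * (\<Sum>k<n. (sqrt (B m k) * ?q k)\<^sup>2)"
        by (rule Cauchy_Schwarz_ineq_sum)
      also have "\<dots> = (\<Sum>k<n. B m k) * (\<Sum>k<n. B m k * (?q k)\<^sup>2)"
        by (simp add: nn power_mult_distrib)
      also have "\<dots> \<le> (\<Sum>k<n. B m k * (?q k)\<^sup>2)"
        using row nn by (intro mult_left_le_one_le) (simp_all add: sum_nonneg)
      finally show ?thesis .
    qed
    then have "(\<Sum>m<M. (cmod (\<Sum>k<n. of_real (B m k) * cinner x (e k)))\<^sup>2)
        \<le> (\<Sum>m<M. \<Sum>k<n. B m k * (?q k)\<^sup>2)"
      by (rule sum_mono)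
    also have "\<dots> = (\<Sum>k<n. (\<Sum>m<M. B m k) * (?q k)\<^sup>2)"
      by (subst sum.swap) (simp add: sum_distrib_right)
    also have "\<dots> \<le> (\<Sum>k<n. (?q k)\<^sup>2)"
      using col nn by (intro sum_mono mult_left_le_one_le) (simp_all add: sum_nonneg)
    also have "\<dots> \<le> (norm x)\<^sup>2"
      using Bessel_eq [of "{..<n}" x] by simp
    finally show ?thesis .
  qed
  have ybound: "(\<Sum>m<M. (cmod (y x m))\<^sup>2) \<le> (norm x)\<^sup>2" for M x
  proof (rule LIMSEQ_le_const2)
    show "(\<lambda>n. \<Sum>m<M. (cmod (\<Sum>k<n. of_real (B m k) * cinner x (e k)))\<^sup>2)
        \<longlonglongrightarrow> (\<Sum>m<M. (cmod (y x m))\<^sup>2)"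
      unfolding y_def by (intro tendsto_intros summable_LIMSEQ ys)
    show "\<exists>N. \<forall>n\<ge>N. (\<Sum>m<M. (cmod (\<Sum>k<n. of_real (B m k) * cinner x (e k)))\<^sup>2) \<le> (norm x)\<^sup>2"
      using trunc by blast
  qed
  have ysq: "summable (\<lambda>m. (cmod (y x m))\<^sup>2)" for x
    using ybound [of x] by (intro summableI_nonneg_bounded) auto
  define f where "f x = (\<Sum>m. y x m *\<^sub>C e m)" for x
  have fc: "cinner (f x) (e m) = y x m" for x m
    unfolding f_def by (rule Riesz_Fischer(2) [OF ysq])
  have f_add: "f (x + z) = f x + f z" for x z
    by (rule basis_coeffs_eqI)
      (simp add: fc cinner_add_left y_def distrib_left suminf_add [OF ys ys])
  have f_scale: "f (c *\<^sub>C x) = c *\<^sub>C f x" for c x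
    by (rule basis_coeffs_eqI)
      (simp add: fc cinner_scaleC_left y_def mult.left_commute suminf_mult [OF ys])
  have f_norm: "norm (f x) \<le> norm x" for x
  proof (rule power2_le_imp_le)
    have "(norm (f x))\<^sup>2 = (\<Sum>m. (cmod (y x m))\<^sup>2)"
      using Parseval [of "f x"] by (simp add: fc sums_iff)
    also have "\<dots> \<le> (norm x)\<^sup>2"
      using ybound by (intro suminf_le_const ysq)
    finally show "(norm (f x))\<^sup>2 \<le> (norm x)\<^sup>2" .
  qed simp
  have bl: "bounded_linear f"
    using f_scale [of "of_real _"] f_norm f_add
    by (intro bounded_linear_intro [of _ 1]) (simp_all add: scaleC_of_real)
  show ?thesis
  proof
    show "Blinfun f \<in> BH"
      using f_scale by (simp add: BH_def bounded_linear_Blinfun_apply [OF bl])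
    show "norm (Blinfun f) \<le> 1"
      using f_norm by (intro norm_blinfun_bound) (simp_all add: bounded_linear_Blinfun_apply [OF bl])
    show "mcoeff e (Blinfun f) m k = of_real (B m k)" for m k
    proof -
      have "(\<lambda>j. of_real (B m j) * cinner (e k) (e j)) = (\<lambda>j. if j = k then complex_of_real (B m k) else 0)"
        by (auto simp: cinner_basis)
      then have "y (e k) m = of_real (B m k)"
        using sums_single [of k "\<lambda>_. complex_of_real (B m k)"] by (simp add: y_def sums_iff)
      then show ?thesis
        by (simp add: mcoeff_def bounded_linear_Blinfun_apply [OF bl] fc)
    qed
  qed
qed

text \<open>The definite description is resolved by applying the Schur test to the permutation
  matrix of \<open>\<rho>\<close>, which also supplies the norm bound; uniqueness is
  \<open>BH_eqI\<close>.\<close>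

lemma std_rep:
  assumes "bij \<rho>"
  shows "std_rep e \<rho> \<in> BH" and "blinfun_apply (std_rep e \<rho>) (e n) = e (\<rho> n)"
    and "norm (std_rep e \<rho>) \<le> 1"
proof -
  define B where "B m k = (if m = \<rho> k then 1 else 0 :: real)" for m k
  have "(\<Sum>k<n. B m k) \<le> 1" for m n
  proof -
    have "(\<Sum>k<n. B m k) = (\<Sum>k<n. if k = inv \<rho> m then 1 else 0)"
      unfolding B_def by (intro sum.cong if_cong refl) (metis assms bij_inv_eq_iff)
    then show ?thesis by simp
  qed
  moreover have "(\<Sum>m<n. B m k) \<le> 1" for k n
    by (simp add: B_def)
  ultimately obtain b where b: "b \<in> BH" "norm b \<le> 1" "\<And>m k. mcoeff e b m k = of_real (B m k)"
    using substochastic_operator [of B thesis] by (simp add: B_def)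
  have be: "blinfun_apply b (e k) = e (\<rho> k)" for k
    using b(3) by (intro basis_coeffs_eqI) (auto simp: mcoeff_def B_def cinner_basis)
  have "std_rep e \<rho> = b"
    unfolding std_rep_def
    using b be by (intro the_equality BH_eqI) (auto simp: mcoeff_def)
  then show "std_rep e \<rho> \<in> BH" "blinfun_apply (std_rep e \<rho>) (e n) = e (\<rho> n)"
    "norm (std_rep e \<rho>) \<le> 1"
    using b be by auto
qed

end

section \<open>Birkhoff's theorem\<close>

text \<open>Gaussian elimination: an equation with a nonzero coefficient at \<open>p\<close> is
  solved for the unknown \<open>p\<close> and substituted into the others. This gives the
  coefficients \<open>c'\<close>, with one equation and one unknown fewer, and \<open>z\<close>
  extends the solution by the value forced at \<open>p\<close>.\<close>

lemma underdetermined_system: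
  fixes c :: "'e \<Rightarrow> 'i \<Rightarrow> real"
  assumes "finite E" "finite I" "card E < card I"
  shows "\<exists>x. (\<exists>i\<in>I. x i \<noteq> 0) \<and> (\<forall>e\<in>E. (\<Sum>i\<in>I. c e i * x i) = 0)"
  using assms
proof (induction E arbitrary: I c rule: finite_induct)
  case empty
  then show ?case
    by (intro exI [of _ "\<lambda>_. 1"]) (auto simp: card_gt_0_iff)
next
  case (insert e E)
  show ?case
  proof (cases "\<forall>i\<in>I. c e i = 0")
    case True
    then show ?thesis
      using insert.IH [of I c] insert.prems insert.hyps by simp
  next
    case False
    then obtain p where p: "p \<in> I" "c e p \<noteq> 0" by blast
    define I' where "I' = I - {p}"
    define c' where "c' f i = c f i - c f p * c e i / c e p" for f i
    have fin: "finite I'"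
      using insert.prems by (simp add: I'_def)
    have "card E < card I'"
      using insert.prems insert.hyps p by (simp add: I'_def)
    then obtain x where x: "\<exists>i\<in>I'. x i \<noteq> 0" "\<And>f. f \<in> E \<Longrightarrow> (\<Sum>i\<in>I'. c' f i * x i) = 0"
      using insert.IH [of I' c'] fin by blast
    define z where "z = x (p := - (\<Sum>i\<in>I'. c e i * x i) / c e p)"
    have split: "(\<Sum>i\<in>I. c f i * z i) = (\<Sum>i\<in>I'. c' f i * x i)" if "f = e \<or> f \<in> E" for f
    proof -
      have "(\<Sum>i\<in>I. c f i * z i) = c f p * z p + (\<Sum>i\<in>I'. c f i * z i)"
        unfolding I'_def using insert.prems p by (intro sum.remove) auto
      also have "(\<Sum>i\<in>I'. c f i * z i) = (\<Sum>i\<in>I'. c f i * x i)"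
        by (rule sum.cong) (auto simp: z_def I'_def)
      finally show ?thesis
        using p by (simp add: z_def c'_def left_diff_distrib sum_subtractf sum_distrib_left
            sum_divide_distrib mult.assoc)
    qed
    have "(\<Sum>i\<in>I. c f i * z i) = 0" if "f \<in> insert e E" for f
    proof (cases "f \<in> E")
      case True
      then show ?thesis using split x(2) by simp
    next
      case False
      then have "f = e" using that by simp
      moreover have "c' e i = 0" for i
        using p by (simp add: c'_def)
      ultimately show ?thesis
        using split by simp
    qed
    moreover have "\<exists>i\<in>I. z i \<noteq> 0"
      using x(1) by (auto simp: z_def I'_def)
    ultimately show ?thesis by blast
  qed
qed

lemma card_le_half_of_fibres:
  assumes "finite F" "\<And>y. y \<in> f ` F \<Longrightarrow> 2 \<le> card {x \<in> F. f x = y}"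
  shows "2 * card (f ` F) \<le> card F"
proof -
  have "2 * card (f ` F) = (\<Sum>y\<in>f ` F. 2)" by simp
  also have "\<dots> \<le> (\<Sum>y\<in>f ` F. card {x \<in> F. f x = y})"
    using assms(2) by (rule sum_mono)
  also have "\<dots> = card F"
    using sum.image_gen [OF assms(1), of "\<lambda>_. 1 :: nat" f] by simp
  finally show ?thesis .
qed

text \<open>Every line meeting \<open>F\<close> meets it twice, so there are at most \<open>card F\<close> lines; as the row sums
  and the column sums have the same total, one of the equations is redundant and a nonzero solution
  exists.\<close>

lemma zero_line_sums_direction:
  assumes S: "finite S" and F: "F \<subseteq> S \<times> S" "F \<noteq> {}"
    and row: "\<And>i j. (i, j) \<in> F \<Longrightarrow> \<exists>j'. j' \<noteq> j \<and> (i, j') \<in> F"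
    and col: "\<And>i j. (i, j) \<in> F \<Longrightarrow> \<exists>i'. i' \<noteq> i \<and> (i', j) \<in> F"
  obtains x :: "'a \<Rightarrow> 'a \<Rightarrow> real"
  where "\<forall>i j. (i, j) \<notin> F \<longrightarrow> x i j = 0" "\<exists>(i, j)\<in>F. x i j \<noteq> 0"
    "\<forall>i\<in>S. (\<Sum>j\<in>S. x i j) = 0" "\<forall>j\<in>S. (\<Sum>i\<in>S. x i j) = 0"
proof -
  have fin: "finite F"
    using F S by (meson finite_SigmaI finite_subset)
  obtain i0 j0 where ij0: "(i0, j0) \<in> F" using F(2) by auto
  define R where "R = fst ` F"
  define C where "C = snd ` F"
  have two: "2 \<le> card A" if "finite A" "a \<in> A" "b \<in> A" "a \<noteq> b" for A and a b :: "'a \<times> 'a"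
    using card_mono [OF that(1), of "{a, b}"] that by simp
  have "2 * card R \<le> card F"
    unfolding R_def
  proof (rule card_le_half_of_fibres [OF fin])
    fix i assume "i \<in> fst ` F"
    then obtain j j' where "(i, j) \<in> F" "(i, j') \<in> F" "j' \<noteq> j"
      using row by fastforce
    then show "2 \<le> card {x \<in> F. fst x = i}"
      using fin by (intro two [of _ "(i, j)" "(i, j')"]) auto
  qed
  moreover have "2 * card C \<le> card F"
    unfolding C_def
  proof (rule card_le_half_of_fibres [OF fin])
    fix j assume "j \<in> snd ` F"
    then obtain i i' where "(i, j) \<in> F" "(i', j) \<in> F" "i' \<noteq> i"
      using col by fastforce
    then show "2 \<le> card {x \<in> F. snd x = j}"
      using fin by (intro two [of _ "(i, j)" "(i', j)"]) auto
  qed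
  moreover have "card R > 0" "finite R" "finite C" "i0 \<in> R"
    using fin ij0 by (auto simp: R_def C_def card_gt_0_iff image_iff intro!: bexI [of _ "(i0, j0)"])
  \<comment> \<open>\<open>Inl i\<close> stands for the equation of row \<open>i\<close> and
    \<open>Inr j\<close> for that of column \<open>j\<close>. Leaving out the row \<open>i0\<close>
    makes the number of equations strictly smaller than \<open>card F\<close>.\<close>
  moreover define E where "E = Inl ` (R - {i0}) \<union> Inr ` C"
  moreover have "card E = card (R - {i0}) + card C"
    unfolding E_def using \<open>finite R\<close> \<open>finite C\<close>
    by (subst card_Un_disjoint) (auto simp: card_image)
  ultimately have finE: "finite E" and "card E < card F"
    by (simp_all add: E_def)
  define c :: "'a + 'a \<Rightarrow> 'a \<times> 'a \<Rightarrow> real" where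
    "c f p = case_sum (\<lambda>i. if fst p = i then 1 else 0) (\<lambda>j. if snd p = j then 1 else 0) f" for f p
  obtain y where y: "\<exists>p\<in>F. y p \<noteq> 0" "\<And>f. f \<in> E \<Longrightarrow> (\<Sum>p\<in>F. c f p * y p) = 0"
    using underdetermined_system [OF finE fin \<open>card E < card F\<close>, of c] by blast
  define x where "x i j = (if (i, j) \<in> F then y (i, j) else 0)" for i j
  have total: "(\<Sum>p\<in>F. h p * y p) = (\<Sum>i\<in>S. \<Sum>j\<in>S. h (i, j) * x i j)" for h
  proof -
    have "(\<Sum>p\<in>F. h p * y p) = (\<Sum>p\<in>S \<times> S. h p * x (fst p) (snd p))"
      using F S by (intro sum.mono_neutral_cong_left) (auto simp: x_def)
    then show ?thesis
      by (simp add: sum.cartesian_product split_def)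
  qed
  have colsum: "(\<Sum>i\<in>S. x i j) = 0" if "j \<in> S" for j
  proof (cases "j \<in> C")
    case True
    then have "0 = (\<Sum>i\<in>S. \<Sum>j'\<in>S. c (Inr j) (i, j') * x i j')"
      using y(2) [of "Inr j"] by (simp add: E_def total)
    also have "\<dots> = (\<Sum>i\<in>S. x i j)"
      using that S by (intro sum.cong refl) (simp add: c_def if_distrib if_distribR cong: if_cong)
    finally show ?thesis by simp
  next
    case False
    then show ?thesis
      by (intro sum.neutral) (force simp: x_def C_def)
  qed
  have rowsum': "(\<Sum>j\<in>S. x i j) = 0" if "i \<in> S" "i \<noteq> i0" for i
  proof (cases "i \<in> R")
    case True
    then have "0 = (\<Sum>i'\<in>S. \<Sum>j\<in>S. c (Inl i) (i', j) * x i' j)"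
      using y(2) [of "Inl i"] that by (simp add: E_def total)
    also have "\<dots> = (\<Sum>i'\<in>S. if i' = i then \<Sum>j\<in>S. x i' j else 0)"
      by (intro sum.cong refl) (simp add: c_def)
    also have "\<dots> = (\<Sum>j\<in>S. x i j)"
      using that S by simp
    finally show ?thesis by simp
  next
    case False
    then show ?thesis
      by (intro sum.neutral) (force simp: x_def R_def)
  qed
  have "(\<Sum>j\<in>S. x i0 j) = (\<Sum>i\<in>S. \<Sum>j\<in>S. x i j)"
    using F ij0 S rowsum' by (subst sum.remove [of S i0]) auto
  also have "\<dots> = 0"
    by (subst sum.swap) (simp add: colsum)
  finally have rowsum: "(\<Sum>j\<in>S. x i j) = 0" if "i \<in> S" for i
    using rowsum' that by (cases "i = i0") auto
  show ?thesis
  proof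
    show "\<exists>(i, j)\<in>F. x i j \<noteq> 0"
      using y(1) by (auto simp: x_def)
  qed (use rowsum colsum in \<open>auto simp: x_def\<close>)
qed

section \<open>Mixtures of permutation matrices\<close>

definition doubly_stochastic :: "'a set \<Rightarrow> ('a \<Rightarrow> 'a \<Rightarrow> real) \<Rightarrow> bool" where
  "doubly_stochastic S A \<longleftrightarrow> (\<forall>i\<in>S. \<forall>j\<in>S. 0 \<le> A i j) \<and>
     (\<forall>i\<in>S. (\<Sum>j\<in>S. A i j) = 1) \<and> (\<forall>j\<in>S. (\<Sum>i\<in>S. A i j) = 1)"

text \<open>A permutation \<open>p\<close> contributes the matrix with a one in row
  \<open>p j\<close> of column \<open>j\<close>, the convention of the standard representation,
  where the basis vector with index \<open>j\<close> is sent to the one with index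
  \<open>p j\<close>.\<close>

definition permutation_mixture :: "'a set \<Rightarrow> ('a \<Rightarrow> 'a \<Rightarrow> real) \<Rightarrow> bool" where
  "permutation_mixture S A \<longleftrightarrow> (\<exists>w. (\<forall>p. 0 \<le> w p) \<and> (\<Sum>p | p permutes S. w p) = 1 \<and>
     (\<forall>i\<in>S. \<forall>j\<in>S. A i j = (\<Sum>p | p permutes S. w p * (if p j = i then 1 else 0))))"

lemma permutation_mixture_convex:
  assumes "permutation_mixture S A" "permutation_mixture S B" "0 \<le> u" "0 \<le> v" "u + v = 1"
    and "\<And>i j. i \<in> S \<Longrightarrow> j \<in> S \<Longrightarrow> C i j = u * A i j + v * B i j"
  shows "permutation_mixture S C"
proof -
  obtain f where f: "\<forall>p. 0 \<le> f p" "(\<Sum>p | p permutes S. f p) = 1"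
    "\<forall>i\<in>S. \<forall>j\<in>S. A i j = (\<Sum>p | p permutes S. f p * (if p j = i then 1 else 0))"
    using assms(1) unfolding permutation_mixture_def by (elim exE conjE) (rule that)
  obtain g where g: "\<forall>p. 0 \<le> g p" "(\<Sum>p | p permutes S. g p) = 1"
    "\<forall>i\<in>S. \<forall>j\<in>S. B i j = (\<Sum>p | p permutes S. g p * (if p j = i then 1 else 0))"
    using assms(2) unfolding permutation_mixture_def by (elim exE conjE) (rule that)
  show ?thesis
    unfolding permutation_mixture_def
  proof (intro exI [of _ "\<lambda>p. u * f p + v * g p"] conjI allI ballI)
    show "(\<Sum>p | p permutes S. u * f p + v * g p) = 1"
      using f(2) g(2) assms(5) by (simp add: sum.distrib flip: sum_distrib_left)
    show "C i j = (\<Sum>p | p permutes S. (u * f p + v * g p) * (if p j = i then 1 else 0))"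
      if "i \<in> S" "j \<in> S" for i j
    proof -
      have "C i j = u * A i j + v * B i j"
        by (rule assms(6) [OF that])
      also have "A i j = (\<Sum>p | p permutes S. f p * (if p j = i then 1 else 0))"
        using f(3) that by blast
      also have "B i j = (\<Sum>p | p permutes S. g p * (if p j = i then 1 else 0))"
        using g(3) that by blast
      finally show ?thesis
        by (simp only: sum.distrib sum_distrib_left distrib_right mult.assoc)
    qed
    show "0 \<le> u * f p + v * g p" for p
      using f(1) g(1) assms(3,4) by simp
  qed
qed

lemma permutation_mixture_permutation:
  assumes "finite S" "q permutes S"
  shows "permutation_mixture S (\<lambda>i j. if q j = i then 1 else 0)"
  unfolding permutation_mixture_def
proof (intro exI [of _ "\<lambda>p. if p = q then 1 else 0"] conjI allI ballI)
  have fin: "finite {p. p permutes S}"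
    using assms(1) by (rule finite_permutations)
  show "(\<Sum>p | p permutes S. if p = q then 1 else 0 :: real) = 1"
    using fin assms(2) by simp
  show "(if q j = i then 1 else 0 :: real) =
      (\<Sum>p | p permutes S. (if p = q then 1 else 0) * (if p j = i then 1 else 0))" for i j
  proof -
    have "(\<Sum>p | p permutes S. (if p = q then 1 else 0) * (if p j = i then 1 else 0))
        = (\<Sum>p | p permutes S. if p = q then if q j = i then 1 else 0 else 0 :: real)"
      by (intro sum.cong) auto
    then show ?thesis
      using fin assms(2) by simp
  qed
qed simp

lemma doubly_stochastic_01:
  assumes S: "finite S" and A: "doubly_stochastic S A"
    and A01: "\<And>i j. i \<in> S \<Longrightarrow> j \<in> S \<Longrightarrow> A i j = 0 \<or> A i j = 1"
  shows "permutation_mixture S A"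
proof -
  have unique: "\<exists>!i. i \<in> S \<and> f i = 1"
    if "(\<Sum>i\<in>S. f i) = (1 :: real)" "\<And>i. i \<in> S \<Longrightarrow> f i = 0 \<or> f i = 1" for f :: "'a \<Rightarrow> real"
  proof -
    have "(\<Sum>i\<in>S. f i) = (\<Sum>i\<in>S. if f i = 1 then 1 else 0)"
      using that(2) by (intro sum.cong) auto
    then have "real (card {i \<in> S. f i = 1}) = 1"
      using that(1) S by (simp add: sum.If_cases Int_def)
    then have "card {i \<in> S. f i = 1} = 1"
      by simp
    then obtain i where "{i \<in> S. f i = 1} = {i}"
      by (rule card_1_singletonE)
    then show ?thesis by (intro ex1I [of _ i]) auto
  qed
  have ucol: "\<exists>!i. i \<in> S \<and> A i j = 1" if "j \<in> S" for j
    using A A01 that by (intro unique) (auto simp: doubly_stochastic_def)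
  have urow: "\<exists>!j. j \<in> S \<and> A i j = 1" if "i \<in> S" for i
    using A A01 that by (intro unique) (auto simp: doubly_stochastic_def)
  define q where "q j = (if j \<in> S then THE i. i \<in> S \<and> A i j = 1 else j)" for j
  have q: "q j \<in> S" "A (q j) j = 1" if "j \<in> S" for j
    using theI' [OF ucol [OF that]] that by (auto simp: q_def)
  have inj: "inj_on q S"
  proof (rule inj_onI)
    fix j k assume jk: "j \<in> S" "k \<in> S" "q j = q k"
    then have "A (q j) j = 1" "A (q j) k = 1"
      using q(2) [OF jk(1)] q(2) [OF jk(2)] by simp_all
    then show "j = k"
      using urow [OF q(1) [OF jk(1)]] jk(1,2) by blast
  qed
  then have "bij_betw q S S"
    using q(1) S by (simp add: bij_betw_def endo_inj_surj image_subsetI)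
  then have "q permutes S"
    by (rule bij_imp_permutes) (simp add: q_def)
  then have mix: "permutation_mixture S (\<lambda>i j. if q j = i then 1 else 0)"
    by (rule permutation_mixture_permutation [OF S])
  \<comment> \<open>\<open>A\<close> is known to agree with the permutation matrix only on
    \<open>S\<close>, so the mixture is transferred through the convexity lemma with weights 1 and
    0.\<close>
  show ?thesis
  proof (rule permutation_mixture_convex [OF mix mix, of 1 0])
    show "A i j = 1 * (if q j = i then 1 else 0) + 0 * (if q j = i then 1 else 0)"
      if "i \<in> S" "j \<in> S" for i j
      using q [OF that(2)] ucol [OF that(2)] A01 [OF that] that(1) by auto
  qed simp_all
qed

text \<open>Adding multiples of \<open>x\<close> keeps all line sums. A nonzero \<open>x\<close>
  with zero row sums has a negative entry, so the smallest ratio \<open>h\<close> over the negative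
  entries is the largest step that keeps the matrix nonnegative; an entry attaining it becomes zero,
  and outside \<open>F\<close> nothing changes.\<close>

lemma move_to_boundary:
  assumes S: "finite S" and A: "doubly_stochastic S A"
    and F: "F = {(i, j) \<in> S \<times> S. A i j \<noteq> 0}"
    and x: "\<And>i j. (i, j) \<notin> F \<Longrightarrow> x i j = 0" "\<exists>(i, j)\<in>F. x i j \<noteq> 0"
      "\<And>i. i \<in> S \<Longrightarrow> (\<Sum>j\<in>S. x i j) = 0" "\<And>j. j \<in> S \<Longrightarrow> (\<Sum>i\<in>S. x i j) = 0"
  obtains t where "t > 0" "doubly_stochastic S (\<lambda>i j. A i j + t * x i j)"
    "{(i, j) \<in> S \<times> S. A i j + t * x i j \<noteq> 0} \<subset> F"
proof -
  define N where "N = {p \<in> F. x (fst p) (snd p) < 0}"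
  define h where "h p = A (fst p) (snd p) / - x (fst p) (snd p)" for p
  have "finite F"
    using S by (auto intro: finite_subset [of _ "S \<times> S"] simp: F)
  then have finN: "finite N"
    by (simp add: N_def)
  have "N \<noteq> {}"
  proof
    assume "N = {}"
    have nn: "x i j \<ge> 0" for i j
    proof (cases "(i, j) \<in> F")
      case True
      then have "(i, j) \<notin> N" using \<open>N = {}\<close> by simp
      with True show ?thesis by (simp add: N_def)
    qed (use x(1) in simp)
    obtain i j where ij: "(i, j) \<in> F" "x i j \<noteq> 0"
      using x(2) by blast
    then have "i \<in> S" "j \<in> S" "0 < x i j"
      using nn [of i j] by (auto simp: F)
    then have "(\<Sum>j\<in>S. x i j) > 0"
      using S nn by (intro sum_pos2 [of _ j])
    then show False
      using x(3) \<open>i \<in> S\<close> by simp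
  qed
  define t where "t = Min (h ` N)"
  have nonneg: "A i j \<ge> 0" if "i \<in> S" "j \<in> S" for i j
    using A that by (simp add: doubly_stochastic_def)
  have "h p > 0" if "p \<in> N" for p
  proof -
    have "0 \<le> A (fst p) (snd p)" "A (fst p) (snd p) \<noteq> 0" "x (fst p) (snd p) < 0"
      using that nonneg by (auto simp: N_def F)
    then show ?thesis
      by (simp add: h_def divide_pos_neg)
  qed
  then have t: "t > 0"
    using finN \<open>N \<noteq> {}\<close> by (simp add: t_def)
  have "t \<in> h ` N"
    unfolding t_def using finN \<open>N \<noteq> {}\<close> by (intro Min_in) auto
  then obtain p where p: "p \<in> N" "t = h p"
    by blast
  have ge: "A i j + t * x i j \<ge> 0" if "i \<in> S" "j \<in> S" for i j
  proof (cases "(i, j) \<in> N")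
    case True
    then have "t \<le> h (i, j)"
      using finN by (simp add: t_def)
    then show ?thesis
      using True by (simp add: h_def N_def field_simps)
  next
    case False
    then have "x i j \<ge> 0"
      using x(1) [of i j] by (cases "(i, j) \<in> F") (auto simp: N_def)
    then show ?thesis
      using t nonneg [OF that] by simp
  qed
  show ?thesis
  proof (rule that [OF t])
    show "doubly_stochastic S (\<lambda>i j. A i j + t * x i j)"
      using A ge x(3,4) by (simp add: doubly_stochastic_def sum.distrib flip: sum_distrib_left)
    have "{(i, j) \<in> S \<times> S. A i j + t * x i j \<noteq> 0} \<subseteq> F"
      using x(1) by (auto simp: F)
    moreover have "A (fst p) (snd p) + t * x (fst p) (snd p) = 0"
      using p by (simp add: h_def N_def)
    then have "p \<notin> {(i, j) \<in> S \<times> S. A i j + t * x i j \<noteq> 0}"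
      by (simp add: split_def)
    moreover have "p \<in> F"
      using p by (simp add: N_def)
    ultimately show "{(i, j) \<in> S \<times> S. A i j + t * x i j \<noteq> 0} \<subset> F"
      by blast
  qed
qed

text \<open>Induction on the size of the support. If some entry is fractional, a direction
  \<open>x\<close> supported on the fractional entries can be followed both ways until an entry
  vanishes; \<open>A\<close> lies between the two end points, both of smaller support.\<close>

theorem Birkhoff:
  assumes S: "finite S" and "doubly_stochastic S A"
  shows "permutation_mixture S A"
  using assms(2)
proof (induction "card {(i, j) \<in> S \<times> S. A i j \<noteq> 0}" arbitrary: A rule: less_induct)
  case less
  define F where "F = {(i, j) \<in> S \<times> S. A i j \<noteq> 0}"
  define F' where "F' = {(i, j) \<in> S \<times> S. A i j \<noteq> 0 \<and> A i j \<noteq> 1}"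
  have finF: "finite F"
    using S by (auto intro: finite_subset [of _ "S \<times> S"] simp: F_def)
  note A = less.prems [unfolded doubly_stochastic_def]
  \<comment> \<open>A line of total 1 with a fractional entry has a second one: the remaining
    entries have a sum strictly between 0 and 1. This provides the two hypotheses on
    \<open>F'\<close> needed for a direction with zero line sums.\<close>
  have other: "\<exists>k. k \<noteq> j \<and> k \<in> S \<and> f k \<noteq> 0 \<and> f k \<noteq> 1"
    if f: "(\<Sum>i\<in>S. f i) = (1 :: real)" "\<And>i. i \<in> S \<Longrightarrow> f i \<ge> 0" "j \<in> S" "f j \<noteq> 0" "f j \<noteq> 1"
    for f j
  proof -
    have eq: "f j + (\<Sum>i\<in>S - {j}. f i) = 1"
      using f(1,3) S by (simp add: sum.remove)
    then have "(\<Sum>i\<in>S - {j}. f i) \<noteq> 0"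
      using f(5) by simp
    then obtain k where k: "k \<in> S - {j}" "f k \<noteq> 0"
      using sum.not_neutral_contains_not_neutral by blast
    have "f k \<le> (\<Sum>i\<in>S - {j}. f i)"
      using k S f(2) by (intro member_le_sum) auto
    moreover have "f j > 0"
      using f(2) [OF f(3)] f(4) by simp
    ultimately have "f k \<noteq> 1"
      using eq by simp
    then show ?thesis using k by blast
  qed
  show ?case
  proof (cases "F' = {}")
    case True
    then have "A i j = 0 \<or> A i j = 1" if "i \<in> S" "j \<in> S" for i j
      using that unfolding F'_def by blast
    then show ?thesis
      by (rule doubly_stochastic_01 [OF S less.prems])
  next
    case False
    have F'_sub: "F' \<subseteq> S \<times> S"
      by (auto simp: F'_def)
    have row: "\<exists>j'. j' \<noteq> j \<and> (i, j') \<in> F'" if "(i, j) \<in> F'" for i j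
      using that A other [of "A i" j] by (auto simp: F'_def)
    have col: "\<exists>i'. i' \<noteq> i \<and> (i', j) \<in> F'" if "(i, j) \<in> F'" for i j
      using that A other [of "\<lambda>i. A i j" i] by (auto simp: F'_def)
    obtain x :: "'a \<Rightarrow> 'a \<Rightarrow> real" where x: "\<forall>i j. (i, j) \<notin> F' \<longrightarrow> x i j = 0" "\<exists>(i, j)\<in>F'. x i j \<noteq> 0"
      "\<forall>i\<in>S. (\<Sum>j\<in>S. x i j) = 0" "\<forall>j\<in>S. (\<Sum>i\<in>S. x i j) = 0"
      by (rule zero_line_sums_direction [OF S F'_sub False row col])
    have sub: "F' \<subseteq> F"
      by (auto simp: F'_def F_def)
    have mix: "\<exists>t>0. permutation_mixture S (\<lambda>i j. A i j + t * z i j)"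
      if z: "z = x \<or> z = (\<lambda>i j. - x i j)" for z
    proof -
      have z_out: "z i j = 0" if "(i, j) \<notin> F" for i j
      proof -
        have "x i j = 0"
          using x(1) sub that by blast
        then show ?thesis
          using z by auto
      qed
      have z_ne: "\<exists>(i, j)\<in>F. z i j \<noteq> 0"
      proof -
        obtain i j where "(i, j) \<in> F'" "x i j \<noteq> 0"
          using x(2) by blast
        then show ?thesis
          using z sub by (intro bexI [of _ "(i, j)"]) auto
      qed
      have z_row: "(\<Sum>j\<in>S. z i j) = 0" if "i \<in> S" for i
        using z bspec [OF x(3) that] by (auto simp: sum_negf)
      have z_col: "(\<Sum>i\<in>S. z i j) = 0" if "j \<in> S" for j
        using z bspec [OF x(4) that] by (auto simp: sum_negf)
      obtain t where t: "t > 0" "doubly_stochastic S (\<lambda>i j. A i j + t * z i j)"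
        "{(i, j) \<in> S \<times> S. A i j + t * z i j \<noteq> 0} \<subset> F"
        by (rule move_to_boundary [OF S less.prems F_def z_out z_ne z_row z_col])
      have "card {(i, j) \<in> S \<times> S. A i j + t * z i j \<noteq> 0} < card F"
        using t(3) finF by (rule psubset_card_mono [rotated])
      then have "permutation_mixture S (\<lambda>i j. A i j + t * z i j)"
        unfolding F_def by (rule less.hyps [OF _ t(2)])
      then show ?thesis
        using t(1) by blast
    qed
    obtain s where s: "s > 0" "permutation_mixture S (\<lambda>i j. A i j + s * x i j)"
      using mix by blast
    obtain t where t: "t > 0" "permutation_mixture S (\<lambda>i j. A i j + t * - x i j)"
      using mix by blast
    show ?thesis
    \<comment> \<open>The end points lie at distances \<open>s\<close> and \<open>t\<close> from
      \<open>A\<close> in opposite directions, so each is weighted by the distance to the other and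
      the multiples of \<open>x\<close> cancel.\<close>
    proof (rule permutation_mixture_convex [OF s(2) t(2)])
      show "0 \<le> t / (s + t)" "0 \<le> s / (s + t)" "t / (s + t) + s / (s + t) = 1"
        using s(1) t(1) by (simp_all add: add_divide_distrib [symmetric])
      show "A i j = t / (s + t) * (A i j + s * x i j) + s / (s + t) * (A i j + t * - x i j)" for i j
      proof -
        have "t / (s + t) * (A i j + s * x i j) + s / (s + t) * (A i j + t * - x i j)
            = (t * (A i j + s * x i j) + s * (A i j + t * - x i j)) / (s + t)"
          by (simp only: times_divide_eq_left add_divide_distrib)
        also have "t * (A i j + s * x i j) + s * (A i j + t * - x i j) = A i j * (s + t)"
          by (simp add: algebra_simps)
        finally show ?thesis
          using s(1) t(1) by simp
      qed
    qed
  qed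
qed

text \<open>The leading block \<open>A\<close> is completed to a doubly stochastic matrix of twice the size whose other
  diagonal block is the transpose of \<open>A\<close> and whose off-diagonal blocks are diagonal and hold the
  deficits of the row and column sums.\<close>

lemma substochastic_permutation_mixture:
  fixes A :: "nat \<Rightarrow> nat \<Rightarrow> real"
  assumes nn: "\<And>i j. 0 \<le> A i j"
    and row: "\<And>i n. (\<Sum>j<n. A i j) \<le> 1"
    and col: "\<And>j n. (\<Sum>i<n. A i j) \<le> 1"
  obtains w where "\<And>p. 0 \<le> w p" "(\<Sum>p | p permutes {..<2 * N}. w p) = 1"
    "\<And>i j. i < N \<Longrightarrow> j < N \<Longrightarrow>
       A i j = (\<Sum>p | p permutes {..<2 * N}. w p * (if p j = i then 1 else 0))"
proof -
  define B where "B i j =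
    (if i < N then
       if j < N then A i j else if j - N = i then 1 - (\<Sum>k<N. A i k) else 0
     else if j < N then if i - N = j then 1 - (\<Sum>k<N. A k j) else 0
     else A (j - N) (i - N))" for i j
  have split: "(\<Sum>j<2 * N. f j) = (\<Sum>j<N. f j) + (\<Sum>j<N. f (j + N))" for f :: "nat \<Rightarrow> real"
  proof -
    have "(\<Sum>j<N + M. f j) = (\<Sum>j<N. f j) + (\<Sum>j<M. f (j + N))" for M
      by (induction M) (simp_all add: add.commute add.left_commute)
    from this [of N] show ?thesis
      by (simp add: mult_2)
  qed
  have "doubly_stochastic {..<2 * N} B"
    unfolding doubly_stochastic_def
  proof (intro conjI ballI)
    show "0 \<le> B i j" for i j
      using nn row col by (simp add: B_def)
    show "(\<Sum>j<2 * N. B i j) = 1" if "i \<in> {..<2 * N}" for i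
    proof (cases "i < N")
      case False
      then have "i - N < N" using that by simp
      moreover have "(\<Sum>j<N. if i - N = j then 1 - (\<Sum>k<N. A k j) else 0)
          = 1 - (\<Sum>k<N. A k (i - N))"
        using \<open>i - N < N\<close> by simp
      ultimately show ?thesis using False by (simp add: split B_def)
    qed (simp add: split B_def)
    show "(\<Sum>i<2 * N. B i j) = 1" if "j \<in> {..<2 * N}" for j
    proof (cases "j < N")
      case False
      then have "j - N < N" using that by simp
      moreover have "(\<Sum>i<N. if j - N = i then 1 - (\<Sum>k<N. A i k) else 0)
          = 1 - (\<Sum>k<N. A (j - N) k)"
        using \<open>j - N < N\<close> by simp
      ultimately show ?thesis using False by (simp add: split B_def)
    qed (simp add: split B_def)
  qed
  then have "permutation_mixture {..<2 * N} B"
    by (intro Birkhoff) simp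
  then obtain w where w: "\<forall>p. 0 \<le> w p" "(\<Sum>p | p permutes {..<2 * N}. w p) = 1"
    "\<forall>i\<in>{..<2 * N}. \<forall>j\<in>{..<2 * N}.
       B i j = (\<Sum>p | p permutes {..<2 * N}. w p * (if p j = i then 1 else 0))"
    unfolding permutation_mixture_def by (elim exE conjE) (rule that)
  have "A i j = (\<Sum>p | p permutes {..<2 * N}. w p * (if p j = i then 1 else 0))"
    if "i < N" "j < N" for i j
  proof -
    have "A i j = B i j"
      using that by (simp add: B_def)
    moreover have "i \<in> {..<2 * N}" "j \<in> {..<2 * N}"
      using that by simp_all
    ultimately show ?thesis
      using w(3) by simp
  qed
  then show ?thesis
    using w(1,2) by (intro that [of w]) blast+
qed

section \<open>A minimax theorem\<close>

lemma continuous_map_sup_attained: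
  fixes f :: "'a \<Rightarrow> real"
  assumes "compactin X K" "K \<noteq> {}" "continuous_map X euclideanreal f"
  obtains x where "x \<in> K" "\<And>y. y \<in> K \<Longrightarrow> f y \<le> f x"
proof -
  have "compact (f ` K)"
    using image_compactin [OF assms(1,3)] by simp
  then show ?thesis
    using compact_attains_sup [of "f ` K"] assms(2) that by auto
qed

lemma compactin_continuous_ge:
  fixes f :: "'a \<Rightarrow> real"
  assumes "compactin X Y" "continuous_map X euclideanreal f"
  shows "compactin X {y \<in> Y. r \<le> f y}"
proof -
  have "closedin X {y \<in> topspace X. f y \<in> {r..}}"
    by (rule closedin_continuous_map_preimage [OF assms(2)]) simp
  then have "compactin X (Y \<inter> {y \<in> topspace X. f y \<in> {r..}})"
    by (intro compact_Int_closedin [OF assms(1)])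
  moreover have "Y \<inter> {y \<in> topspace X. f y \<in> {r..}} = {y \<in> Y. r \<le> f y}"
    using compactin_subset_topspace [OF assms(1)] by auto
  ultimately show ?thesis by simp
qed

text \<open>The slope \<open>\<alpha>\<close> is the largest value of \<open>- h / g\<close> where \<open>h\<close> is nonnegative. If \<open>\<alpha> g + h\<close> were
  nonnegative at a point where \<open>g\<close> is, then the point between it and the maximizer at which the
  interpolation of \<open>g\<close> vanishes would make both functions nonnegative.\<close>

lemma two_function_alternative:
  fixes g h :: "'a \<Rightarrow> real"
  assumes Y: "compactin X Y"
    and g: "continuous_map X euclideanreal g" and h: "continuous_map X euclideanreal h"
    and cc: "\<And>x y u v. \<lbrakk>x \<in> Y; y \<in> Y; 0 \<le> u; 0 \<le> v; u + v = 1\<rbrakk> \<Longrightarrow>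
      \<exists>z\<in>Y. u * g x + v * g y \<le> g z \<and> u * h x + v * h y \<le> h z"
    and neg: "\<And>y. y \<in> Y \<Longrightarrow> g y < 0 \<or> h y < 0"
  obtains u v where "0 \<le> u" "0 \<le> v" "u + v = 1" "\<forall>y\<in>Y. u * g y + v * h y < 0"
proof -
  define A where "A = {y \<in> Y. 0 \<le> g y}"
  define B where "B = {y \<in> Y. 0 \<le> h y}"
  have comp: "compactin X A" "compactin X B"
    unfolding A_def B_def by (rule compactin_continuous_ge [OF Y g], rule compactin_continuous_ge [OF Y h])
  have gneg: "g y < 0" if "y \<in> B" for y
    using neg that by (force simp: B_def)
  have hneg: "h y < 0" if "y \<in> A" for y
    using neg that by (force simp: A_def)
  show ?thesis
  proof (cases "A = {} \<or> B = {}")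
    case True
    then show ?thesis
    proof
      assume "A = {}"
      then show ?thesis
        by (intro that [of 1 0]) (auto simp: A_def not_le)
    next
      assume "B = {}"
      then show ?thesis
        by (intro that [of 0 1]) (auto simp: B_def not_le)
    qed
  next
    case False
    then have ne: "A \<noteq> {}" "B \<noteq> {}" by auto
    have "continuous_map (subtopology X B) euclideanreal (\<lambda>y. h y / - g y)"
    proof (intro continuous_map_real_divide continuous_map_minus continuous_map_from_subtopology g h)
      show "- g y \<noteq> 0" if "y \<in> topspace (subtopology X B)" for y
        using gneg [of y] that by simp
    qed
    moreover have "compactin (subtopology X B) B"
      using comp(2) by (simp add: compactin_subtopology)
    ultimately obtain b where b: "b \<in> B" "\<And>y. y \<in> B \<Longrightarrow> h y / - g y \<le> h b / - g b"
      using continuous_map_sup_attained [OF _ ne(2)] by blast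
    define \<alpha> where "\<alpha> = h b / - g b"
    have gb: "g b < 0" "0 \<le> h b" "b \<in> Y"
      using gneg [OF b(1)] b(1) by (auto simp: B_def)
    then have \<alpha>: "0 \<le> \<alpha>" and hb: "h b = - \<alpha> * g b"
      by (auto simp: \<alpha>_def divide_nonneg_nonpos)
    have Aneg: "\<alpha> * g x + h x < 0" if "x \<in> A" for x
    proof (rule ccontr)
      assume "\<not> \<alpha> * g x + h x < 0"
      then have hx: "h x \<ge> - \<alpha> * g x" by simp
      have gx: "0 \<le> g x" "x \<in> Y"
        using that by (auto simp: A_def)
      define d where "d = g x - g b"
      have d: "d > 0"
        using gx gb by (simp add: d_def)
      define u where "u = - g b / d"
      define v where "v = g x / d"
      have uv: "0 \<le> u" "0 \<le> v" "u + v = 1" "u * g x + v * g b = 0"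
      proof -
        show "0 \<le> u" "0 \<le> v"
          using d gx gb by (simp_all add: u_def v_def divide_nonpos_pos)
        have "u + v = d / d"
          unfolding u_def v_def add_divide_distrib [symmetric] by (simp add: d_def)
        then show "u + v = 1"
          using d by simp
        show "u * g x + v * g b = 0"
          by (simp add: u_def v_def)
      qed
      obtain z where z: "z \<in> Y" "0 \<le> g z" "u * h x + v * h b \<le> h z"
        using cc [OF gx(2) gb(3) uv(1-3)] unfolding uv(4) by blast
      have "0 = - \<alpha> * (u * g x + v * g b)"
        using uv by simp
      also have "\<dots> = u * (- \<alpha> * g x) + v * h b"
        by (simp add: hb algebra_simps)
      also have "\<dots> \<le> u * h x + v * h b"
        using hx uv by (intro add_right_mono mult_left_mono)
      finally show False
        using neg [OF z(1)] z by simp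
    qed
    have "continuous_map X euclideanreal (\<lambda>x. \<alpha> * g x + h x)"
      using g h by (intro continuous_map_add continuous_map_real_mult_left)
    then obtain a where a: "a \<in> A" "\<And>x. x \<in> A \<Longrightarrow> \<alpha> * g x + h x \<le> \<alpha> * g a + h a"
      using continuous_map_sup_attained [OF comp(1) ne(1)] by blast
    obtain a' where a': "a' \<in> A" "\<And>x. x \<in> A \<Longrightarrow> g x \<le> g a'"
      using continuous_map_sup_attained [OF comp(1) ne(1) g] by blast
    \<comment> \<open>On \<open>B\<close> strictness requires a slope above \<open>\<alpha>\<close>,
      while on \<open>A\<close> the slope may rise only as far as the margin \<open>\<delta>\<close>
      permits. The denominator \<open>g a' + 1\<close> exceeds every value of \<open>g\<close> on
      \<open>A\<close> and is positive even if \<open>g a'\<close> is zero.\<close>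
    define \<delta> where "\<delta> = - (\<alpha> * g a + h a)"
    define \<mu> where "\<mu> = \<alpha> + \<delta> / (g a' + 1)"
    have \<delta>: "\<delta> > 0"
      using Aneg [OF a(1)] by (simp add: \<delta>_def)
    have ga': "0 \<le> g a'"
      using a'(1) by (simp add: A_def)
    have \<mu>: "\<mu> > \<alpha>"
      using \<delta> ga' by (simp add: \<mu>_def)
    have neg\<mu>: "\<mu> * g y + h y < 0" if y: "y \<in> Y" for y
    proof -
      consider "y \<in> A" | "y \<in> B" | "g y < 0" "h y < 0"
        using y unfolding A_def B_def by fastforce
      then show ?thesis
      proof cases
        case 1
        have "\<delta> * g y < \<delta> * (g a' + 1)"
          using a'(2) [OF 1] \<delta> by simp
        then have "\<delta> / (g a' + 1) * g y < \<delta>"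
          using ga' by (simp add: field_simps)
        then show ?thesis
          using a(2) [OF 1] by (simp add: \<mu>_def \<delta>_def algebra_simps)
      next
        case 2
        have "h y / - g y \<le> \<alpha>"
          using b(2) [OF 2] by (simp add: \<alpha>_def)
        then have "h y / - g y < \<mu>"
          using \<mu> by simp
        then show ?thesis
          using gneg [OF 2] by (simp add: field_simps)
      next
        case 3
        then have "\<mu> * g y \<le> 0"
          using \<mu> \<alpha> by (simp add: mult_nonneg_nonpos)
        then show ?thesis using 3 by simp
      qed
    qed
    show ?thesis
    proof (rule that [of "\<mu> / (1 + \<mu>)" "1 / (1 + \<mu>)"])
      show "0 \<le> \<mu> / (1 + \<mu>)" "0 \<le> 1 / (1 + \<mu>)" "\<mu> / (1 + \<mu>) + 1 / (1 + \<mu>) = 1"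
        using \<mu> \<alpha> by (simp_all add: add_divide_distrib [symmetric])
      show "\<forall>y\<in>Y. \<mu> / (1 + \<mu>) * g y + 1 / (1 + \<mu>) * h y < 0"
      proof
        fix y assume "y \<in> Y"
        have "\<mu> / (1 + \<mu>) * g y + 1 / (1 + \<mu>) * h y = (\<mu> * g y + h y) / (1 + \<mu>)"
          by (simp add: add_divide_distrib)
        then show "\<mu> / (1 + \<mu>) * g y + 1 / (1 + \<mu>) * h y < 0"
          using neg\<mu> [OF \<open>y \<in> Y\<close>] \<mu> \<alpha> by (simp add: divide_neg_pos)
      qed
    qed
  qed
qed

text \<open>On the part \<open>Y'\<close> of \<open>Y\<close> where \<open>g d\<close> is not
  negative, \<open>D\<close> already suffices, so induction gives one \<open>c\<close> for
  \<open>Y'\<close>. Then \<open>c\<close> and \<open>d\<close> together cover \<open>Y\<close>, and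
  the alternative for two functions merges them. Concavity is required with one \<open>z\<close> for
  all of \<open>C\<close>, so that \<open>Y'\<close> inherits it.\<close>

lemma minimax_finite:
  fixes g :: "'c \<Rightarrow> 'a \<Rightarrow> real"
  assumes cont: "\<And>c. c \<in> C \<Longrightarrow> continuous_map X euclideanreal (g c)"
    and convexlike: "\<And>c d u v. \<lbrakk>c \<in> C; d \<in> C; 0 \<le> u; 0 \<le> v; u + v = 1\<rbrakk> \<Longrightarrow>
      \<exists>k\<in>C. \<forall>x\<in>topspace X. g k x \<le> u * g c x + v * g d x"
    and "finite D" "D \<noteq> {}" "D \<subseteq> C" "compactin X Y"
    and "\<And>x y u v. \<lbrakk>x \<in> Y; y \<in> Y; 0 \<le> u; 0 \<le> v; u + v = 1\<rbrakk> \<Longrightarrow>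
      \<exists>z\<in>Y. \<forall>c\<in>C. u * g c x + v * g c y \<le> g c z"
    and "\<And>x. x \<in> Y \<Longrightarrow> \<exists>c\<in>D. g c x < 0"
  shows "\<exists>c\<in>C. \<forall>x\<in>Y. g c x < 0"
  using assms(3-)
proof (induction D arbitrary: Y rule: finite_ne_induct)
  case (singleton d)
  then show ?case by (intro bexI [of _ d]) auto
next
  case (insert d D)
  define Y' where "Y' = {y \<in> Y. 0 \<le> g d y}"
  have d: "d \<in> C" using insert.prems(1) by simp
  have "\<exists>c\<in>C. \<forall>x\<in>Y'. g c x < 0"
  proof (rule insert.IH)
    show "compactin X Y'"
      unfolding Y'_def by (rule compactin_continuous_ge [OF insert.prems(2) cont [OF d]])
    show "\<exists>z\<in>Y'. \<forall>c\<in>C. u * g c x + v * g c y \<le> g c z"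
      if xy: "x \<in> Y'" "y \<in> Y'" "0 \<le> u" "0 \<le> v" "u + v = 1" for x y and u v :: real
    proof -
      obtain z where z: "z \<in> Y" "\<forall>c\<in>C. u * g c x + v * g c y \<le> g c z"
        using insert.prems(3) [of x y u v] xy by (auto simp: Y'_def)
      have "0 \<le> u * g d x + v * g d y"
        using xy by (simp add: Y'_def)
      then have "z \<in> Y'"
        using z(1) bspec [OF z(2) d] by (simp add: Y'_def)
      then show ?thesis using z by blast
    qed
    show "\<exists>c\<in>D. g c x < 0" if "x \<in> Y'" for x
      using insert.prems(4) [of x] that by (auto simp: Y'_def)
    show "D \<subseteq> C"
      using insert.prems(1) by simp
  qed
  then obtain c where c: "c \<in> C" "\<And>x. x \<in> Y' \<Longrightarrow> g c x < 0" by blast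
  have two: "\<exists>z\<in>Y. u * g c x + v * g c y \<le> g c z \<and> u * g d x + v * g d y \<le> g d z"
    if "x \<in> Y" "y \<in> Y" "0 \<le> u" "0 \<le> v" "u + v = 1" for x y and u v :: real
    using insert.prems(3) [OF that] c(1) d by blast
  have cover: "g c y < 0 \<or> g d y < 0" if "y \<in> Y" for y
    using c(2) [of y] that by (auto simp: Y'_def not_le)
  obtain u v where uv: "0 \<le> u" "0 \<le> v" "u + v = 1" "\<forall>y\<in>Y. u * g c y + v * g d y < 0"
    by (rule two_function_alternative [OF insert.prems(2) cont [OF c(1)] cont [OF d] two cover])
  obtain k where k: "k \<in> C" "\<forall>x\<in>topspace X. g k x \<le> u * g c x + v * g d x"
    using convexlike [OF c(1) d uv(1-3)] by blast
  show ?case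
  proof (intro bexI ballI)
    fix y assume "y \<in> Y"
    then have "g k y \<le> u * g c y + v * g d y"
      using k(2) compactin_subset_topspace [OF insert.prems(2)] by blast
    then show "g k y < 0"
      using bspec [OF uv(4) \<open>y \<in> Y\<close>] by linarith
  qed (rule k)
qed

text \<open>A one-sided form of the Ky Fan minimax theorem for concave-convexlike functions.\<close>

lemma minimax:
  fixes g :: "'c \<Rightarrow> 'a \<Rightarrow> real"
  assumes X: "compact_space X" and "C \<noteq> {}"
    and cont: "\<And>c. c \<in> C \<Longrightarrow> continuous_map X euclideanreal (g c)"
    and convexlike: "\<And>c d u v. \<lbrakk>c \<in> C; d \<in> C; 0 \<le> u; 0 \<le> v; u + v = 1\<rbrakk> \<Longrightarrow>
      \<exists>k\<in>C. \<forall>x\<in>topspace X. g k x \<le> u * g c x + v * g d x"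
    and concavelike: "\<And>x y u v. \<lbrakk>x \<in> topspace X; y \<in> topspace X; 0 \<le> u; 0 \<le> v; u + v = 1\<rbrakk> \<Longrightarrow>
      \<exists>z\<in>topspace X. \<forall>c\<in>C. u * g c x + v * g c y \<le> g c z"
    and neg: "\<And>x. x \<in> topspace X \<Longrightarrow> \<exists>c\<in>C. g c x < 0"
  shows "\<exists>c\<in>C. \<forall>x\<in>topspace X. g c x < 0"
proof -
  define U where "U c = {x \<in> topspace X. g c x \<in> {..<0}}" for c
  have "openin X (U c)" if "c \<in> C" for c
    unfolding U_def by (rule openin_continuous_map_preimage [OF cont [OF that]]) simp
  moreover have "topspace X \<subseteq> \<Union> (U ` C)"
    using neg by (force simp: U_def)
  moreover have comp: "compactin X (topspace X)"
    using X by (simp add: compact_space_def)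
  ultimately obtain F where F: "finite F" "F \<subseteq> U ` C" "topspace X \<subseteq> \<Union> F"
    using compactinD [of X "topspace X" "U ` C"] by blast
  obtain D where D: "D \<subseteq> C" "finite D" "F = U ` D"
    using finite_subset_image [OF F(1,2)] by blast
  \<comment> \<open>Inserting \<open>c0\<close> keeps the finite set nonempty even if the space, and
    with it the subcover, is empty.\<close>
  obtain c0 where "c0 \<in> C" using \<open>C \<noteq> {}\<close> by blast
  have "\<exists>c\<in>insert c0 D. g c x < 0" if "x \<in> topspace X" for x
    using F(3) that unfolding D(3) by (force simp: U_def)
  then show ?thesis
    using D(1,2) \<open>c0 \<in> C\<close> comp
    by (intro minimax_finite [where D = "insert c0 D" and X = X] cont convexlike concavelike) simp_all
qed

section \<open>The Mackey topology\<close>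

lemma topspace_mackey_topology [simp]: "topspace (mackey_topology V F) = V"
proof -
  \<comment> \<open>For empty \<open>K\<close> the condition on \<open>b\<close> is vacuous, so
    \<open>V\<close> itself is one of the generating sets.\<close>
  have "compactin (sigma_topology F V) {}" "convex_functionals V {}"
    by (simp_all add: convex_functionals_def)
  then have "V \<in> {{b \<in> V. \<forall>f\<in>K. cmod (f b - f a) < r} | a K r.
      a \<in> V \<and> K \<subseteq> F \<and> convex_functionals V K \<and> compactin (sigma_topology F V) K \<and> 0 < r}"
    if "a \<in> V" for a
    using that by (intro CollectI exI [of _ a] exI [of _ "{}"] exI [of _ 1]) simp
  then show ?thesis
    unfolding mackey_topology_def topology_generated_by_topspace
    by (intro subset_antisym Union_least subsetI) (blast, rule UnionI)
qed

lemma continuous_map_sigma_eval: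
  "v \<in> V \<Longrightarrow> continuous_map (sigma_topology F V) euclidean (\<lambda>f. f v)"
  unfolding sigma_topology_def
  by (intro continuous_map_from_subtopology) (rule continuous_map_product_projection)

text \<open>The generating balls have arbitrary centres, and this recentres them at
  \<open>a\<close>. A finite family with a common radius is kept, rather than a single
  \<open>K\<close>, because a union of convex sets need not be convex.\<close>

lemma mackey_neighbourhood:
  assumes "openin (mackey_topology V F) T" "a \<in> T"
  shows "\<exists>\<K> r. finite \<K> \<and> (0 :: real) < r \<and>
     (\<forall>K\<in>\<K>. K \<subseteq> F \<and> convex_functionals V K \<and> compactin (sigma_topology F V) K) \<and>
     (\<forall>b\<in>V. (\<forall>K\<in>\<K>. \<forall>f\<in>K. cmod (f b - f a) < r) \<longrightarrow> b \<in> T)"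
proof -
  have "a \<in> V"
    using openin_subset [OF assms(1)] assms(2) by auto
  define nice where "nice \<K> \<longleftrightarrow> finite \<K> \<and>
     (\<forall>K\<in>\<K>. K \<subseteq> F \<and> convex_functionals V K \<and> compactin (sigma_topology F V) K)" for \<K>
  define near where "near \<K> r b \<longleftrightarrow> (\<forall>K\<in>\<K>. \<forall>f\<in>K. cmod (f b - f a) < r)"
    for \<K> and r :: real and b
  have "\<exists>\<K> r. nice \<K> \<and> 0 < r \<and> (\<forall>b\<in>V. near \<K> r b \<longrightarrow> b \<in> T)"
    using assms unfolding mackey_topology_def openin_topology_generated_by_iff
  proof (induction rule: generate_topology_on.induct)
    case Empty
    then show ?case by simp
  next
    case (Int S T)
    obtain \<K> r where 1: "nice \<K>" "0 < r" "\<forall>b\<in>V. near \<K> r b \<longrightarrow> b \<in> S"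
      using Int.IH(1) Int.prems by blast
    obtain \<L> s where 2: "nice \<L>" "0 < s" "\<forall>b\<in>V. near \<L> s b \<longrightarrow> b \<in> T"
      using Int.IH(2) Int.prems by blast
    have "near \<K> r b" "near \<L> s b" if "near (\<K> \<union> \<L>) (min r s) b" for b
      using that by (auto simp: near_def)
    moreover have "nice (\<K> \<union> \<L>)"
      using 1(1) 2(1) by (auto simp: nice_def)
    moreover have "0 < min r s"
      using 1(2) 2(2) by simp
    ultimately show ?case
      using 1(3) 2(3) by (intro exI [of _ "\<K> \<union> \<L>"] exI [of _ "min r s"]) blast
  next
    case (UN \<U>)
    then obtain S where "S \<in> \<U>" "a \<in> S" by blast
    then obtain \<K> r where "nice \<K>" "0 < r" "\<forall>b\<in>V. near \<K> r b \<longrightarrow> b \<in> S"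
      using UN.IH by blast
    then show ?case
      using \<open>S \<in> \<U>\<close> by (intro exI [of _ \<K>] exI [of _ r]) blast
  next
    case (Basis S)
    from Basis.hyps obtain c K r where S: "S = {b \<in> V. \<forall>f\<in>K. cmod (f b - f c) < r}" and "c \<in> V"
      and K: "K \<subseteq> F" "convex_functionals V K" "compactin (sigma_topology F V) K"
      unfolding mem_Collect_eq by (elim exE conjE) (rule that)
    \<comment> \<open>The distance from the centre \<open>c\<close> to \<open>a\<close> attains its
      supremum over the compact set \<open>K\<close>, so it stays below \<open>r\<close> by a
      uniform margin.\<close>
    have "\<exists>s>0. \<forall>f\<in>K. cmod (f a - f c) + s \<le> r"
    proof (cases "K = {}")
      case True
      then show ?thesis by (auto intro: exI [of _ 1])
    next
      case False
      have "continuous_map (sigma_topology F V) euclideanreal (\<lambda>f. cmod (f a - f c))"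
        using \<open>a \<in> V\<close> \<open>c \<in> V\<close>
        by (intro continuous_map_norm continuous_map_diff continuous_map_sigma_eval)
      then obtain f where "f \<in> K" "\<And>g. g \<in> K \<Longrightarrow> cmod (g a - g c) \<le> cmod (f a - f c)"
        using continuous_map_sup_attained [OF K(3) False] by blast
      moreover have "cmod (f a - f c) < r"
        using Basis.prems \<open>f \<in> K\<close> unfolding S by blast
      ultimately show ?thesis
        by (intro exI [of _ "r - cmod (f a - f c)"]) simp
    qed
    then obtain s where s: "s > 0" "\<And>f. f \<in> K \<Longrightarrow> cmod (f a - f c) + s \<le> r" by blast
    have "b \<in> S" if "b \<in> V" "near {K} s b" for b
    proof -
      have "cmod (f b - f c) < r" if "f \<in> K" for f
      proof -
        have "cmod (f b - f a) < s"
          using \<open>near {K} s b\<close> that by (simp add: near_def)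
        then show ?thesis
          using s(2) [OF that] norm_triangle_ineq [of "f b - f a" "f a - f c"] by simp
      qed
      then show ?thesis using that by (simp add: S)
    qed
    then show ?case
      using s(1) K by (intro exI [of _ "{K}"] exI [of _ s]) (auto simp: nice_def)
  qed
  then obtain \<K> r where "nice \<K>" "0 < r" "\<forall>b\<in>V. near \<K> r b \<longrightarrow> b \<in> T" by blast
  then show ?thesis
    unfolding nice_def near_def by (intro exI [of _ \<K>] exI [of _ r] conjI) simp_all
qed

text \<open>The singleton of \<open>f\<close> is an admissible compact convex set. Extensionality
  makes \<open>f\<close> a point of the product space and makes its convex combinations, which are
  restricted to \<open>V\<close>, return \<open>f\<close>.\<close>

lemma continuous_map_mackey_functional:
  assumes "f \<in> F" "f \<in> extensional V"
  shows "continuous_map (mackey_topology V F) euclidean f"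
proof -
  let ?X = "mackey_topology V F"
  have "(\<lambda>x\<in>V. complex_of_real u * f x + complex_of_real v * f x) = f" if "u + v = 1" for u v
  proof -
    have "complex_of_real u * w + complex_of_real v * w = w" for w
      using that by (metis distrib_right mult_1 of_real_1 of_real_add)
    then show ?thesis
      using extensional_restrict [OF assms(2)] by simp
  qed
  then have conv: "convex_functionals V {f}"
    by (simp add: convex_functionals_def)
  have comp: "compactin (sigma_topology F V) {f}"
    using assms by (simp add: sigma_topology_def PiE_def)
  have ball: "openin ?X {b \<in> V. cmod (f b - f a) < r}" if "a \<in> V" "r > 0" for a r
    unfolding mackey_topology_def
  proof (rule topology_generated_by_Basis, intro CollectI exI conjI)
    show "{b \<in> V. cmod (f b - f a) < r} = {b \<in> V. \<forall>f\<in>{f}. cmod (f b - f a) < r}"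
      by simp
  qed (use assms conv comp that in auto)
  show ?thesis
    unfolding continuous_map
  proof (intro conjI allI impI)
    fix U :: "complex set" assume "openin euclidean U"
    then have "open U" by simp
    have "{b \<in> V. f b \<in> U}
        = \<Union> {{b \<in> V. cmod (f b - f a) < r} | a r. a \<in> V \<and> r > 0 \<and> ball (f a) r \<subseteq> U}" (is "?L = ?R")
    proof
      have "b \<in> ?L" if "b \<in> V" "cmod (f b - f a) < r" "ball (f a) r \<subseteq> U" for a b r
        using that by (auto simp: dist_norm norm_minus_commute)
      then show "?R \<subseteq> ?L" by blast
      show "?L \<subseteq> ?R"
      proof
        fix b assume "b \<in> ?L"
        then obtain r where "r > 0" "ball (f b) r \<subseteq> U" "b \<in> V"
          using \<open>open U\<close> open_contains_ball by blast
        moreover have "b \<in> {c \<in> V. cmod (f c - f b) < r}"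
          using \<open>r > 0\<close> \<open>b \<in> V\<close> by simp
        ultimately show "b \<in> ?R"
          by blast
      qed
    qed
    moreover have "openin ?X ?R"
      using ball by (intro openin_Union) blast
    ultimately show "openin ?X {x \<in> topspace ?X. f x \<in> U}"
      by simp
  qed simp
qed

text \<open>By the minimax theorem it is enough to approximate \<open>a\<close> on one linear combination of functionals
  at a time, the compact side being a product of cones over the given compact convex sets.\<close>

lemma mackey_closure_of_convex:
  fixes C :: "'v :: real_vector set"
  assumes C: "C \<subseteq> V" "convex C" and "a \<in> V"
    and affine: "\<And>f c d u v. \<lbrakk>f \<in> F; c \<in> C; d \<in> C; 0 \<le> u; 0 \<le> v; u + v = 1\<rbrakk> \<Longrightarrow>
      f (u *\<^sub>R c + v *\<^sub>R d) = of_real u * f c + of_real v * f d"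
    and approx: "\<And>G \<epsilon>. \<lbrakk>finite G; G \<subseteq> F; 0 < \<epsilon>\<rbrakk> \<Longrightarrow> \<exists>c\<in>C. \<forall>f\<in>G. cmod (f c - f a) < \<epsilon>"
  shows "a \<in> mackey_topology V F closure_of C"
  unfolding in_closure_of
proof (intro conjI allI impI)
  fix T assume T: "a \<in> T \<and> openin (mackey_topology V F) T"
  obtain \<K>0 r where \<K>0: "finite \<K>0" "(0 :: real) < r"
     "\<forall>K\<in>\<K>0. K \<subseteq> F \<and> convex_functionals V K \<and> compactin (sigma_topology F V) K"
     "\<forall>b\<in>V. (\<forall>K\<in>\<K>0. \<forall>f\<in>K. cmod (f b - f a) < r) \<longrightarrow> b \<in> T"
    using mackey_neighbourhood [of V F T a] T by blast
  \<comment> \<open>Empty sets impose no condition and would make the product space below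
    empty.\<close>
  define \<K> where "\<K> = {K \<in> \<K>0. K \<noteq> {}}"
  \<comment> \<open>The modulus is replaced by the real parts of the multiples by 1, -1, \<i> and
    -\<i>, which depend affinely on the functional as the concavity of \<open>g\<close>
    requires.\<close>
  define J where "J = \<K> \<times> {1, -1, \<i>, -\<i>}"
  \<comment> \<open>A pair \<open>(s, f)\<close> represents the cone element \<open>s f\<close>. The
    weight 0 allows single indices to be switched off at the end.\<close>
  define Y where "Y j = prod_topology (top_of_set {0..1 :: real})
    (subtopology (sigma_topology F V) (fst j))" for j :: "('v \<Rightarrow> complex) set \<times> complex"
  define X where "X = product_topology Y J"
  \<comment> \<open>The threshold is \<open>r / 2\<close> because the real and the imaginary part
    are bounded separately and their bounds are added.\<close>
  define g where "g c x = (\<Sum>j\<in>J. fst (x j) * Re (snd j * (snd (x j) c - snd (x j) a))) - r / 2"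
    for c and x :: "('v \<Rightarrow> complex) set \<times> complex \<Rightarrow> real \<times> ('v \<Rightarrow> complex)"
  have finJ: "finite J"
    using \<K>0(1) by (simp add: J_def \<K>_def)
  have K: "K \<subseteq> F" "convex_functionals V K" "compactin (sigma_topology F V) K" "K \<noteq> {}"
    if "K \<in> \<K>" for K
    using \<K>0(3) that by (auto simp: \<K>_def)
  have fstJ: "fst j \<in> \<K>" if "j \<in> J" for j
    using that by (auto simp: J_def)
  have topY: "topspace (Y j) = {0..1} \<times> fst j" if "j \<in> J" for j
    using compactin_subset_topspace [OF K(3) [OF fstJ [OF that]]] by (auto simp: Y_def)
  have topX: "x \<in> topspace X \<longleftrightarrow> x \<in> extensional J \<and>
      (\<forall>j\<in>J. 0 \<le> fst (x j) \<and> fst (x j) \<le> 1 \<and> snd (x j) \<in> fst j)" for x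
    by (auto simp: X_def PiE_iff topY mem_Times_iff)
  have compX: "compact_space X"
    unfolding X_def compact_space_product_topology
  proof (intro disjI2 ballI)
    fix j assume "j \<in> J"
    then have "compact_space (subtopology (sigma_topology F V) (fst j))"
      using K(3) [OF fstJ] by (simp add: compact_space_subtopology)
    then show "compact_space (Y j)"
      by (simp add: Y_def compact_space_prod_topology compact_space_subtopology)
  qed
  have cont: "continuous_map X euclideanreal (g c)" if "c \<in> C" for c
    unfolding g_def
  proof (intro continuous_map_diff continuous_map_sum finJ continuous_map_real_mult)
    fix j assume "j \<in> J"
    then have proj: "continuous_map X (Y j) (\<lambda>x. x j)"
      unfolding X_def by (rule continuous_map_product_projection)
    then show "continuous_map X euclideanreal (\<lambda>x. fst (x j))"
      unfolding Y_def
      by (intro continuous_map_into_fulltopology [OF continuous_map_fst_of, unfolded o_def])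
    have eval: "continuous_map X euclidean (\<lambda>x. snd (x j) v)" if "v \<in> V" for v
    proof -
      have "continuous_map X (sigma_topology F V) (snd \<circ> (\<lambda>x. x j))"
        using proj unfolding Y_def
        by (intro continuous_map_into_fulltopology [OF continuous_map_snd_of])
      from continuous_map_compose [OF this continuous_map_sigma_eval [OF that]]
      show ?thesis by (simp add: o_def)
    qed
    have "continuous_map X euclidean (\<lambda>x. snd (x j) c - snd (x j) a)"
      using \<open>c \<in> C\<close> C(1) \<open>a \<in> V\<close> by (intro continuous_map_diff eval) auto
    moreover have "continuous_map euclidean euclideanreal (\<lambda>w. Re (snd j * w))"
      by (simp only: continuous_map_iff_continuous2) (intro continuous_intros)
    ultimately show "continuous_map X euclideanreal (\<lambda>x. Re (snd j * (snd (x j) c - snd (x j) a)))"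
      using continuous_map_compose [of X euclidean "\<lambda>x. snd (x j) c - snd (x j) a" euclideanreal
          "\<lambda>w. Re (snd j * w)"] by (simp add: o_def)
  qed simp
  have convexlike: "\<exists>k\<in>C. \<forall>x\<in>topspace X. g k x \<le> u * g c x + v * g d x"
    if cd: "c \<in> C" "d \<in> C" "0 \<le> u" "0 \<le> v" "u + v = 1" for c d u v
  proof (intro bexI ballI)
    show "u *\<^sub>R c + v *\<^sub>R d \<in> C"
      by (rule convexD [OF C(2) cd])
    fix x assume x: "x \<in> topspace X"
    have summand: "Re (snd j * (snd (x j) (u *\<^sub>R c + v *\<^sub>R d) - snd (x j) a))
        = u * Re (snd j * (snd (x j) c - snd (x j) a)) + v * Re (snd j * (snd (x j) d - snd (x j) a))"
      if "j \<in> J" for j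
    proof -
      have "snd (x j) \<in> F"
        using x that K(1) [OF fstJ [OF that]] by (auto simp: topX)
      then have "snd (x j) (u *\<^sub>R c + v *\<^sub>R d) = of_real u * snd (x j) c + of_real v * snd (x j) d"
        using cd by (rule affine)
      moreover have "snd (x j) a = of_real (u + v) * snd (x j) a"
        using cd by simp
      ultimately have eq: "snd (x j) (u *\<^sub>R c + v *\<^sub>R d) - snd (x j) a
          = of_real u * (snd (x j) c - snd (x j) a) + of_real v * (snd (x j) d - snd (x j) a)"
        by (simp add: algebra_simps)
      show ?thesis
        unfolding eq by (simp add: algebra_simps)
    qed
    have "(\<Sum>j\<in>J. fst (x j) * Re (snd j * (snd (x j) (u *\<^sub>R c + v *\<^sub>R d) - snd (x j) a)))
        = (\<Sum>j\<in>J. u * (fst (x j) * Re (snd j * (snd (x j) c - snd (x j) a)))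
            + v * (fst (x j) * Re (snd j * (snd (x j) d - snd (x j) a))))"
      by (intro sum.cong refl) (simp only: summand distrib_left mult.left_commute)
    also have "\<dots> = u * (g c x + r / 2) + v * (g d x + r / 2)"
      by (simp only: g_def sum.distrib sum_distrib_left diff_add_cancel)
    finally have "g (u *\<^sub>R c + v *\<^sub>R d) x = u * (g c x + r / 2) + v * (g d x + r / 2) - r / 2"
      by (simp only: g_def)
    also have "\<dots> = u * g c x + v * g d x + (u + v) * (r / 2) - r / 2"
      by (simp add: algebra_simps)
    finally show "g (u *\<^sub>R c + v *\<^sub>R d) x \<le> u * g c x + v * g d x"
      using cd by simp
  qed
  have concavelike: "\<exists>z\<in>topspace X. \<forall>c\<in>C. u * g c x + v * g c y \<le> g c z"
    if xy: "x \<in> topspace X" "y \<in> topspace X" "0 \<le> u" "0 \<le> v" "u + v = 1" for x y u v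
  proof -
    \<comment> \<open>The combination of two cone elements is again one: its weight is
      \<open>s\<close>, and its functional is the convex combination with the weights divided by
      \<open>s\<close>. For \<open>s = 0\<close> both terms vanish and any functional of the set
      serves.\<close>
    have "\<exists>p. 0 \<le> fst p \<and> fst p \<le> 1 \<and> snd p \<in> fst j \<and> (\<forall>b\<in>V.
        of_real (fst p) * snd p b = of_real (u * fst (x j)) * snd (x j) b + of_real (v * fst (y j)) * snd (y j) b)"
      if j: "j \<in> J" for j
    proof -
      define s where "s = u * fst (x j) + v * fst (y j)"
      have x: "0 \<le> fst (x j)" "fst (x j) \<le> 1" "snd (x j) \<in> fst j"
        and y: "0 \<le> fst (y j)" "fst (y j) \<le> 1" "snd (y j) \<in> fst j"
        using xy j by (auto simp: topX)
      have nn: "0 \<le> u * fst (x j)" "0 \<le> v * fst (y j)"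
        using x y xy by simp_all
      have "s \<le> u * 1 + v * 1"
        unfolding s_def using x y xy by (intro add_mono mult_left_mono) simp_all
      then have s1: "0 \<le> s" "s \<le> 1"
        using nn xy by (simp_all add: s_def)
      show ?thesis
      proof (cases "s = 0")
        case True
        then have zero: "u * fst (x j) = 0" "v * fst (y j) = 0"
          using nn by (simp_all only: s_def add_nonneg_eq_0_iff)
        show ?thesis
          unfolding zero using x(3) by (intro exI [of _ "(0, snd (x j))"]) simp
      next
        case False
        define h where "h = (\<lambda>b\<in>V. complex_of_real (u * fst (x j) / s) * snd (x j) b
          + complex_of_real (v * fst (y j) / s) * snd (y j) b)"
        have "u * fst (x j) / s + v * fst (y j) / s = 1"
          using False by (simp add: s_def flip: add_divide_distrib)
        moreover have "0 \<le> u * fst (x j) / s" "0 \<le> v * fst (y j) / s"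
          using nn s1 by simp_all
        ultimately have "h \<in> fst j"
          using K(2) [OF fstJ [OF j]] x(3) y(3) unfolding convex_functionals_def h_def by blast
        moreover have "of_real s * h b = of_real (u * fst (x j)) * snd (x j) b
            + of_real (v * fst (y j)) * snd (y j) b" if "b \<in> V" for b
          using that False by (simp add: h_def distrib_left)
        ultimately show ?thesis
          using s1 by (intro exI [of _ "(s, h)"]) simp
      qed
    qed
    then obtain z where z: "\<And>j. j \<in> J \<Longrightarrow> 0 \<le> fst (z j) \<and> fst (z j) \<le> 1 \<and> snd (z j) \<in> fst j \<and>
        (\<forall>b\<in>V. of_real (fst (z j)) * snd (z j) b
          = of_real (u * fst (x j)) * snd (x j) b + of_real (v * fst (y j)) * snd (y j) b)"
      by metis
    show ?thesis
    proof (intro bexI ballI)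
      show "restrict z J \<in> topspace X"
        using z by (simp add: topX)
      fix c assume "c \<in> C"
      then have "c \<in> V" using C(1) by blast
      have summand: "fst (z j) * Re (snd j * (snd (z j) c - snd (z j) a))
          = u * (fst (x j) * Re (snd j * (snd (x j) c - snd (x j) a)))
          + v * (fst (y j) * Re (snd j * (snd (y j) c - snd (y j) a)))" if "j \<in> J" for j
      proof -
        have scal: "t * Re w = Re (of_real t * w)" for t w by simp
        have "fst (z j) * Re (snd j * (snd (z j) c - snd (z j) a))
            = Re (snd j * (of_real (fst (z j)) * snd (z j) c - of_real (fst (z j)) * snd (z j) a))"
          unfolding scal by (simp only: right_diff_distrib mult.left_commute)
        also have "\<dots> = Re (snd j * (of_real (u * fst (x j)) * (snd (x j) c - snd (x j) a)
            + of_real (v * fst (y j)) * (snd (y j) c - snd (y j) a)))"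
        proof -
          have zb: "of_real (fst (z j)) * snd (z j) b
              = of_real (u * fst (x j)) * snd (x j) b + of_real (v * fst (y j)) * snd (y j) b" if "b \<in> V" for b
            using z [OF \<open>j \<in> J\<close>] that by blast
          show ?thesis
            unfolding zb [OF \<open>c \<in> V\<close>] zb [OF \<open>a \<in> V\<close>] by (simp only: algebra_simps)
        qed
        also have "\<dots> = u * (fst (x j) * Re (snd j * (snd (x j) c - snd (x j) a)))
            + v * (fst (y j) * Re (snd j * (snd (y j) c - snd (y j) a)))"
          by (simp add: algebra_simps)
        finally show ?thesis .
      qed
      have "(\<Sum>j\<in>J. fst (restrict z J j) * Re (snd j * (snd (restrict z J j) c - snd (restrict z J j) a)))
          = (\<Sum>j\<in>J. u * (fst (x j) * Re (snd j * (snd (x j) c - snd (x j) a)))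
              + v * (fst (y j) * Re (snd j * (snd (y j) c - snd (y j) a))))"
        by (intro sum.cong refl) (simp only: restrict_apply' summand)
      also have "\<dots> = u * (g c x + r / 2) + v * (g c y + r / 2)"
        by (simp only: g_def sum.distrib sum_distrib_left diff_add_cancel)
      finally have "g c (restrict z J) = u * (g c x + r / 2) + v * (g c y + r / 2) - r / 2"
        by (simp only: g_def)
      also have "\<dots> = u * g c x + v * g c y + (u + v) * (r / 2) - r / 2"
        by (simp add: algebra_simps)
      finally show "u * g c x + v * g c y \<le> g c (restrict z J)"
        using xy by simp
    qed
  qed
  have neg: "\<exists>c\<in>C. g c x < 0" if x: "x \<in> topspace X" for x
  proof -
    \<comment> \<open>A point of \<open>X\<close> carries only one functional per index, so
      approximation on finite sets applies. There are \<open>card J\<close> summands of size at most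
      \<open>\<epsilon>\<close>; the extra 1 keeps the total strictly below
      \<open>r / 2\<close>.\<close>
    define \<epsilon> where "\<epsilon> = r / (2 * (card J + 1))"
    have "\<epsilon> > 0"
      using \<K>0(2) by (simp add: \<epsilon>_def)
    have "(\<lambda>j. snd (x j)) ` J \<subseteq> F"
      using x K(1) [OF fstJ] by (auto simp: topX)
    then obtain c where c: "c \<in> C" "\<And>j. j \<in> J \<Longrightarrow> cmod (snd (x j) c - snd (x j) a) < \<epsilon>"
      using approx [of "(\<lambda>j. snd (x j)) ` J" \<epsilon>] finJ \<open>\<epsilon> > 0\<close> by auto
    have "fst (x j) * Re (snd j * (snd (x j) c - snd (x j) a)) \<le> \<epsilon>" if "j \<in> J" for j
    proof -
      have "cmod (snd j) = 1"
        using that by (auto simp: J_def)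
      then have "\<bar>Re (snd j * (snd (x j) c - snd (x j) a))\<bar> \<le> \<epsilon>"
        using c(2) [OF that] abs_Re_le_cmod [of "snd j * (snd (x j) c - snd (x j) a)"]
        by (simp add: norm_mult)
      moreover have "\<bar>fst (x j)\<bar> \<le> 1"
        using x that by (simp add: topX)
      ultimately have "\<bar>fst (x j) * Re (snd j * (snd (x j) c - snd (x j) a))\<bar> \<le> 1 * \<epsilon>"
        unfolding abs_mult using \<open>\<epsilon> > 0\<close> by (intro mult_mono) simp_all
      then show ?thesis by simp
    qed
    then have "(\<Sum>j\<in>J. fst (x j) * Re (snd j * (snd (x j) c - snd (x j) a))) \<le> (\<Sum>j\<in>J. \<epsilon>)"
      by (rule sum_mono)
    also have "\<dots> = card J * \<epsilon>" by simp
    also have "\<dots> < (card J + 1) * \<epsilon>"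
      using \<open>\<epsilon> > 0\<close> by (simp add: distrib_right)
    also have "\<dots> = r / 2"
      by (simp add: \<epsilon>_def field_simps)
    finally show ?thesis
      using c(1) by (auto simp: g_def)
  qed
  have "C \<noteq> {}"
    using approx [of "{}" 1] by auto
  obtain c where c: "c \<in> C" "\<forall>x\<in>topspace X. g c x < 0"
    using minimax [of X C g, OF compX \<open>C \<noteq> {}\<close> cont convexlike concavelike neg] by blast
  have "cmod (f c - f a) < r" if f: "f \<in> K'" "K' \<in> \<K>" for f K'
  proof -
    have Re_less: "Re (w * (f c - f a)) < r / 2" if "w \<in> {1, -1, \<i>, -\<i>}" for w
    proof -
      have j: "(K', w) \<in> J"
        using f that by (simp add: J_def)
      \<comment> \<open>Weight 1 at \<open>(K', w)\<close> and weight 0 elsewhere isolates a single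
        summand; the chosen functionals at the other indices only make \<open>x\<close> a point of
        the product.\<close>
      define x where "x = (\<lambda>j\<in>J. if j = (K', w) then (1 :: real, f) else (0, SOME h. h \<in> fst j))"
      have "x \<in> topspace X"
        using f K(4) [OF fstJ] by (auto simp: topX x_def some_in_eq)
      then have "g c x < 0"
        using c(2) by blast
      moreover have "(\<Sum>j\<in>J. fst (x j) * Re (snd j * (snd (x j) c - snd (x j) a)))
          = (\<Sum>j\<in>J. if j = (K', w) then Re (w * (f c - f a)) else 0)"
        by (rule sum.cong) (auto simp: x_def)
      ultimately show ?thesis
        using j finJ by (simp add: g_def)
    qed
    have "\<bar>Re (f c - f a)\<bar> < r / 2" "\<bar>Im (f c - f a)\<bar> < r / 2"
      using Re_less [of 1] Re_less [of "-1"] Re_less [of \<i>] Re_less [of "-\<i>"]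
      unfolding abs_less_iff by simp_all
    then show ?thesis
      using cmod_le [of "f c - f a"] by linarith
  qed
  then have "\<forall>K\<in>\<K>0. \<forall>f\<in>K. cmod (f c - f a) < r"
    unfolding \<K>_def by blast
  then have "c \<in> T"
    using \<K>0(4) c(1) C(1) by blast
  then show "\<exists>y. y \<in> C \<and> y \<in> T"
    using c(1) by blast
qed (use \<open>a \<in> V\<close> in simp)

section \<open>Doubly substochastic operators\<close>

lemma subspace_BH: "subspace (BH :: ('h :: chilbert_space \<Rightarrow>\<^sub>L 'h) set)"
proof (rule subspaceI)
  show "r *\<^sub>R a \<in> BH" if "a \<in> BH" for r and a :: "'h \<Rightarrow>\<^sub>L 'h"
    using that by (simp add: BH_def blinfun.scaleR_left scaleC_scaleC mult.commute flip: scaleC_of_real)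
qed (simp_all add: BH_def blinfun.add_left scaleC_add_right)

text \<open>Convex hulls are formed with real scalars, whereas functionals of the predual are
  homogeneous with respect to \<open>scaleC_op\<close>.\<close>

lemma scaleC_op_of_real: "scaleC_op (complex_of_real r) a = r *\<^sub>R a"
  by (rule blinfun_eqI) (simp add: scaleC_op.rep_eq scaleC_of_real blinfun.scaleR_left)

lemma predual_real_linear:
  assumes "f \<in> predual" "c \<in> BH" "d \<in> BH"
  shows "f (u *\<^sub>R c + v *\<^sub>R d) = of_real u * f c + of_real v * f d"
proof -
  have "f (u *\<^sub>R c + v *\<^sub>R d) = f (u *\<^sub>R c) + f (v *\<^sub>R d)"
    using assms subspace_scale [OF subspace_BH] unfolding predual_def by blast
  moreover have "f (scaleC_op z b) = z * f b" if "b \<in> BH" for z b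
    using assms(1) that unfolding predual_def by blast
  then have "f (r *\<^sub>R b) = of_real r * f b" if "b \<in> BH" for r b
    using that by (metis scaleC_op_of_real)
  ultimately show ?thesis
    using assms by simp
qed

lemma mcoeff_add: "mcoeff e (a + b) m k = mcoeff e a m k + mcoeff e b m k"
  by (simp add: mcoeff_def blinfun.add_left cinner_add_left)

lemma mcoeff_scaleR: "mcoeff e (r *\<^sub>R a) m k = of_real r * mcoeff e a m k"
  by (simp add: mcoeff_def blinfun.scaleR_left cinner_scaleR_left)

lemma mcoeff_diff: "mcoeff e (a - b) m k = mcoeff e a m k - mcoeff e b m k"
  by (simp add: mcoeff_def blinfun.diff_left cinner_diff_left)

lemma mcoeff_sum: "mcoeff e (\<Sum>i\<in>I. f i) m k = (\<Sum>i\<in>I. mcoeff e (f i) m k)"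
  by (simp add: mcoeff_def blinfun.sum_left cinner_sum_left)

lemma summable_suminf_le_iff:
  fixes f :: "nat \<Rightarrow> real"
  assumes "\<And>k. 0 \<le> f k"
  shows "summable f \<and> suminf f \<le> c \<longleftrightarrow> (\<forall>n. (\<Sum>k<n. f k) \<le> c)"
proof
  show "\<forall>n. (\<Sum>k<n. f k) \<le> c" if "summable f \<and> suminf f \<le> c"
    using that assms sum_le_suminf [of f] by (meson finite_lessThan order.trans)
  show "summable f \<and> suminf f \<le> c" if "\<forall>n. (\<Sum>k<n. f k) \<le> c"
  proof -
    have "summable f"
      using that assms by (intro summableI_nonneg_bounded [where x = c]) auto
    then show ?thesis
      using that suminf_le_const by blast
  qed
qed

text \<open>Bounding all finite partial sums makes each condition depend on finitely many entries,
  so it passes to entrywise limits and to closures.\<close>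

definition substochastic :: "(nat \<Rightarrow> nat \<Rightarrow> real) \<Rightarrow> bool" where
  "substochastic A \<longleftrightarrow> (\<forall>i j. 0 \<le> A i j) \<and>
     (\<forall>i n. (\<Sum>j<n. A i j) \<le> 1) \<and> (\<forall>j n. (\<Sum>i<n. A i j) \<le> 1)"

lemma substochastic_le_1:
  assumes "substochastic A"
  shows "A i j \<le> 1"
proof -
  have "A i j \<le> (\<Sum>j<Suc j. A i j)"
    using assms by (intro member_le_sum) (auto simp: substochastic_def)
  also have "\<dots> \<le> 1"
    using assms unfolding substochastic_def by blast
  finally show ?thesis .
qed

lemma DSS_iff:
  "a \<in> DSS e \<longleftrightarrow> a \<in> BH \<and> (\<forall>m k. Im (mcoeff e a m k) = 0) \<and>
     substochastic (\<lambda>m k. Re (mcoeff e a m k))"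
proof -
  have entries: "(\<forall>m k. mcoeff e a m k \<in> \<real>\<^sub>\<ge>\<^sub>0) \<longleftrightarrow>
      (\<forall>m k. Im (mcoeff e a m k) = 0) \<and> (\<forall>m k. 0 \<le> Re (mcoeff e a m k))"
    by (auto simp: complex_nonneg_Reals_iff)
  show ?thesis
  \<comment> \<open>Only nonnegative entries allow series to be traded for bounded partial sums;
    with a negative real part both sides are false.\<close>
  proof (cases "\<forall>m k. 0 \<le> Re (mcoeff e a m k)")
    case True
    then have "summable (\<lambda>k. Re (mcoeff e a m k)) \<and> (\<Sum>k. Re (mcoeff e a m k)) \<le> 1
        \<longleftrightarrow> (\<forall>n. (\<Sum>k<n. Re (mcoeff e a m k)) \<le> 1)"
      "summable (\<lambda>k. Re (mcoeff e a k m)) \<and> (\<Sum>k. Re (mcoeff e a k m)) \<le> 1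
        \<longleftrightarrow> (\<forall>n. (\<Sum>k<n. Re (mcoeff e a k m)) \<le> 1)" for m
      by (simp_all add: summable_suminf_le_iff)
    then have "line_sums_le_1 (mcoeff e a) \<longleftrightarrow>
        (\<forall>m n. (\<Sum>k<n. Re (mcoeff e a m k)) \<le> 1) \<and> (\<forall>m n. (\<Sum>k<n. Re (mcoeff e a k m)) \<le> 1)"
      unfolding line_sums_le_1_def by (simp add: conj_assoc [symmetric] all_conj_distrib)
    then show ?thesis
      unfolding DSS_def substochastic_def mem_Collect_eq entries by blast
  next
    case False
    then show ?thesis
      unfolding DSS_def substochastic_def mem_Collect_eq entries by blast
  qed
qed

lemma convex_DSS: "convex (DSS e)"
proof (rule convexI)
  fix a b u v
  assume a: "a \<in> DSS e" and b: "b \<in> DSS e" and uv: "0 \<le> u" "0 \<le> v" "u + v = (1 :: real)"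
  have "u * x + v * y \<le> 1" if "x \<le> 1" "y \<le> 1" for x y
    using that uv by (rule convex_bound_le)
  then have "substochastic (\<lambda>m k. u * Re (mcoeff e a m k) + v * Re (mcoeff e b m k))"
    using a b uv(1,2)
    by (simp add: DSS_iff substochastic_def sum.distrib flip: sum_distrib_left)
  then show "u *\<^sub>R a + v *\<^sub>R b \<in> DSS e"
    using a b by (simp add: DSS_iff mcoeff_add mcoeff_scaleR
        subspace_add [OF subspace_BH] subspace_scale [OF subspace_BH])
qed

section \<open>From convergence of entries to convergence under the predual\<close>

lemma tendsto_of_dense_tendsto:
  fixes f :: "nat \<Rightarrow> 'a :: real_normed_vector \<Rightarrow> complex"
  assumes X: "X \<longlonglongrightarrow> x"
    and lip: "\<And>n x y. cmod (f n x - f n y) \<le> L * norm (x - y)"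
    and lim: "\<And>K. (\<lambda>n. f n (X K)) \<longlonglongrightarrow> 0"
  shows "(\<lambda>n. f n x) \<longlonglongrightarrow> 0"
proof (rule LIMSEQ_I)
  fix r :: real assume "r > 0"
  have "(\<lambda>K. L * norm (x - X K)) \<longlonglongrightarrow> L * norm (x - x)"
    by (intro tendsto_intros X)
  then have "\<forall>\<^sub>F K in sequentially. L * norm (x - X K) < r / 2"
    using \<open>r > 0\<close> by (intro order_tendstoD(2) [of _ "L * norm (x - x)"]) simp_all
  \<comment> \<open>Since \<open>L\<close> does not depend on \<open>n\<close>, one \<open>K\<close>
    serves all \<open>n\<close> and can be fixed before \<open>n\<close> is made large.\<close>
  then obtain K where K: "L * norm (x - X K) < r / 2"
    by (meson eventually_happens' sequentially_bot)
  obtain N where N: "\<And>n. n \<ge> N \<Longrightarrow> cmod (f n (X K)) < r / 2"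
    using LIMSEQ_D [OF lim [of K], of "r / 2"] \<open>r > 0\<close> by auto
  have "norm (f n x - 0) < r" if "n \<ge> N" for n
    using norm_triangle_ineq [of "f n x - f n (X K)" "f n (X K)"] lip [of n x "X K"] K N [OF that]
    by simp
  then show "\<exists>N. \<forall>n\<ge>N. norm (f n x - 0) < r" by blast
qed

lemma topspace_ultraweak_topology [simp]: "topspace ultraweak_topology = BH"
proof -
  have "(BH :: ('a \<Rightarrow>\<^sub>L 'a) set) \<in>
    {{a \<in> BH. (\<Sum>n. cinner (blinfun_apply a (x n)) (y n)) \<in> U} | x y U.
        summable (\<lambda>n :: nat. (norm (x n))\<^sup>2) \<and> summable (\<lambda>n :: nat. (norm (y n))\<^sup>2) \<and> open U}"
    by (intro CollectI exI [of _ "\<lambda>_. 0"] exI [of _ UNIV]) simp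
  then show ?thesis
    unfolding ultraweak_topology_def topology_generated_by_topspace
    by (intro subset_antisym Union_least subsetI) (blast, rule UnionI)
qed

context
  fixes e :: "nat \<Rightarrow> 'h :: chilbert_space"
  assumes onb: "orthonormal_basis e"
begin

lemma mcoeff_std_rep: "bij \<rho> \<Longrightarrow> mcoeff e (std_rep e \<rho>) m k = (if \<rho> k = m then 1 else 0)"
  by (simp add: mcoeff_def std_rep [OF onb] cinner_basis [OF onb])

lemma std_rep_in_DSS:
  assumes "bij \<rho>"
  shows "std_rep e \<rho> \<in> DSS e"
proof -
  have "(\<Sum>k<n. if \<rho> k = m then 1 else 0 :: real) \<le> 1" for m n
  proof -
    have "(\<Sum>k<n. if \<rho> k = m then 1 else 0 :: real) = (\<Sum>k<n. if k = inv \<rho> m then 1 else 0)"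
      by (intro sum.cong if_cong refl) (metis assms bij_inv_eq_iff)
    then show ?thesis by simp
  qed
  moreover have "(\<Sum>m<n. if \<rho> k = m then 1 else 0 :: real) \<le> 1" for k n
    by simp
  ultimately show ?thesis
    using std_rep(1) [OF onb assms]
    by (simp add: DSS_iff mcoeff_std_rep [OF assms] substochastic_def if_distrib cong: if_cong)
qed

text \<open>The density argument is used twice on the differences \<open>d n\<close>: in
  \<open>x\<close> against a fixed basis vector, then in \<open>y\<close>. The common norm bound
  \<open>L\<close> supplies the Lipschitz constants.\<close>

lemma weak_tendsto:
  fixes c :: "nat \<Rightarrow> 'h \<Rightarrow>\<^sub>L 'h"
  assumes c: "\<And>n. c n \<in> BH" "\<And>n. norm (c n) \<le> M" and a: "a \<in> BH"
    and lim: "\<And>m k. (\<lambda>n. mcoeff e (c n) m k) \<longlonglongrightarrow> mcoeff e a m k"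
  shows "(\<lambda>n. cinner (blinfun_apply (c n) x) y) \<longlonglongrightarrow> cinner (blinfun_apply a x) y"
proof -
  define d where "d n = c n - a" for n
  define L where "L = M + norm a"
  have d: "d n \<in> BH" for n
    unfolding d_def using c(1) a by (rule subspace_diff [OF subspace_BH])
  have dL: "norm (d n) \<le> L" for n
    using norm_triangle_ineq4 [of "c n" a] c(2) [of n] by (simp add: d_def L_def)
  have "0 \<le> L"
    using dL [of 0] norm_ge_zero [of "d 0"] by linarith
  have bound: "cmod (cinner (blinfun_apply (d n) x) y) \<le> L * norm x * norm y" for n x y
  proof -
    have "cmod (cinner (blinfun_apply (d n) x) y) \<le> norm (blinfun_apply (d n) x) * norm y"
      by (rule cinner_Cauchy_Schwarz)
    also have "\<dots> \<le> (norm (d n) * norm x) * norm y"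
      by (intro mult_right_mono norm_blinfun) simp
    also have "\<dots> \<le> (L * norm x) * norm y"
      using dL by (intro mult_right_mono) simp_all
    finally show ?thesis .
  qed
  have partial: "(\<lambda>K. \<Sum>k<K. cinner z (e k) *\<^sub>C e k) \<longlonglongrightarrow> z" for z
    using Fourier_sums [OF onb, of z] by (simp add: sums_def)
  have basis: "(\<lambda>n. cinner (blinfun_apply (d n) x) (e m)) \<longlonglongrightarrow> 0" for x m
  proof (rule tendsto_of_dense_tendsto [where f = "\<lambda>n x. cinner (blinfun_apply (d n) x) (e m)", OF partial])
    show "cmod (cinner (blinfun_apply (d n) x) (e m) - cinner (blinfun_apply (d n) y) (e m))
        \<le> (L * norm (e m)) * norm (x - y)" for n x y
      using bound [of n "x - y" "e m"]
      by (simp add: blinfun.diff_right cinner_diff_left mult.assoc mult.commute mult.left_commute)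
    show "(\<lambda>n. cinner (blinfun_apply (d n) (\<Sum>k<K. cinner x (e k) *\<^sub>C e k)) (e m)) \<longlonglongrightarrow> 0" for K
    proof -
      have eq: "cinner (blinfun_apply (d n) (\<Sum>k<K. cinner x (e k) *\<^sub>C e k)) (e m)
          = (\<Sum>k<K. cinner x (e k) * (mcoeff e (c n) m k - mcoeff e a m k))" for n
        by (simp only: blinfun.sum_right BH_scaleC [OF d] cinner_sum_left cinner_scaleC_left
            mcoeff_diff [symmetric] d_def [symmetric] mcoeff_def [symmetric])
      have "(\<lambda>n. \<Sum>k<K. cinner x (e k) * (mcoeff e (c n) m k - mcoeff e a m k))
          \<longlonglongrightarrow> (\<Sum>k<K. cinner x (e k) * (mcoeff e a m k - mcoeff e a m k))"
        by (intro tendsto_intros lim)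
      then show ?thesis
        by (simp add: eq)
    qed
  qed
  have "(\<lambda>n. cinner (blinfun_apply (d n) x) y) \<longlonglongrightarrow> 0"
  proof (rule tendsto_of_dense_tendsto [where f = "\<lambda>n y. cinner (blinfun_apply (d n) x) y", OF partial])
    show "cmod (cinner (blinfun_apply (d n) x) y - cinner (blinfun_apply (d n) x) z)
        \<le> (L * norm x) * norm (y - z)" for n y z
      using bound [of n x "y - z"] by (simp add: cinner_diff_right)
    show "(\<lambda>n. cinner (blinfun_apply (d n) x) (\<Sum>k<K. cinner y (e k) *\<^sub>C e k)) \<longlonglongrightarrow> 0" for K
    proof -
      have "(\<lambda>n. \<Sum>k<K. cnj (cinner y (e k)) * cinner (blinfun_apply (d n) x) (e k))
          \<longlonglongrightarrow> (\<Sum>k<K. cnj (cinner y (e k)) * 0)"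
        by (intro tendsto_intros basis)
      then show ?thesis
        by (simp add: cinner_sum_right cinner_scaleC_right)
    qed
  qed
  then show ?thesis
    by (simp add: d_def blinfun.diff_left cinner_diff_left LIM_zero_iff)
qed

text \<open>A generating set tests a series of vector functionals. Each term converges by
  \<open>weak_tendsto\<close>, and the norm bound gives a summable majorant independent of
  \<open>n\<close>, so Tannery's theorem exchanges limit and sum.\<close>

lemma ultraweak_eventually:
  fixes c :: "nat \<Rightarrow> 'h \<Rightarrow>\<^sub>L 'h"
  assumes c: "\<And>n. c n \<in> BH" "\<And>n. norm (c n) \<le> M"
    and lim: "\<And>m k. (\<lambda>n. mcoeff e (c n) m k) \<longlonglongrightarrow> mcoeff e a m k"
    and T: "openin ultraweak_topology T" "a \<in> T"
  shows "\<forall>\<^sub>F n in sequentially. c n \<in> T"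
proof -
  have a: "a \<in> BH"
    using openin_subset [OF T(1)] T(2) by auto
  have "0 \<le> M"
    using c(2) [of 0] norm_ge_zero [of "c 0"] by linarith
  show ?thesis
    using T unfolding ultraweak_topology_def openin_topology_generated_by_iff
  proof (induction rule: generate_topology_on.induct)
    case Empty
    then show ?case by simp
  next
    case (Int S T)
    then show ?case by (simp add: eventually_conj)
  next
    case (UN \<U>)
    then obtain S where S: "S \<in> \<U>" "a \<in> S" by blast
    then have "\<forall>\<^sub>F n in sequentially. c n \<in> S"
      using UN.IH by blast
    then show ?case
      by (rule eventually_mono) (use S in blast)
  next
    case (Basis S)
    from Basis.hyps obtain x y :: "nat \<Rightarrow> 'h" and U
      where S: "S = {a \<in> BH. (\<Sum>n. cinner (blinfun_apply a (x n)) (y n)) \<in> U}"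
        and sx: "summable (\<lambda>n. (norm (x n))\<^sup>2)" and sy: "summable (\<lambda>n. (norm (y n))\<^sup>2)" and U: "open U"
      unfolding mem_Collect_eq by (elim exE conjE) (rule that)
    have bound: "cmod (cinner (blinfun_apply (c n) (x j)) (y j)) \<le> M * ((norm (x j))\<^sup>2 + (norm (y j))\<^sup>2)"
      for n j
    proof -
      have "cmod (cinner (blinfun_apply (c n) (x j)) (y j)) \<le> norm (blinfun_apply (c n) (x j)) * norm (y j)"
        by (rule cinner_Cauchy_Schwarz)
      also have "\<dots> \<le> (norm (c n) * norm (x j)) * norm (y j)"
        by (intro mult_right_mono norm_blinfun) simp
      also have "\<dots> \<le> (M * norm (x j)) * norm (y j)"
        using c(2) by (intro mult_right_mono) simp_all
      also have "\<dots> = M * (norm (x j) * norm (y j))"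
        by simp
      also have "\<dots> \<le> M * ((norm (x j))\<^sup>2 + (norm (y j))\<^sup>2)"
      proof (rule mult_left_mono [OF _ \<open>0 \<le> M\<close>])
        have "2 * norm (x j) * norm (y j) \<le> (norm (x j))\<^sup>2 + (norm (y j))\<^sup>2"
          by (rule sum_squares_bound)
        moreover have "0 \<le> norm (x j) * norm (y j)" by simp
        ultimately show "norm (x j) * norm (y j) \<le> (norm (x j))\<^sup>2 + (norm (y j))\<^sup>2"
          by linarith
      qed
      finally show ?thesis .
    qed
    have "(\<lambda>n. \<Sum>j. cinner (blinfun_apply (c n) (x j)) (y j))
        \<longlonglongrightarrow> (\<Sum>j. cinner (blinfun_apply a (x j)) (y j))"
    proof (rule tannerys_theorem [THEN conjunct2, THEN conjunct2])
      show "summable (\<lambda>j. M * ((norm (x j))\<^sup>2 + (norm (y j))\<^sup>2))"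
        by (intro summable_mult summable_add sx sy)
      show "\<forall>\<^sub>F (j, n) in at_top \<times>\<^sub>F sequentially.
          norm (cinner (blinfun_apply (c n) (x j)) (y j)) \<le> M * ((norm (x j))\<^sup>2 + (norm (y j))\<^sup>2)"
        using bound by (intro always_eventually) auto
      show "(\<lambda>n. cinner (blinfun_apply (c n) (x j)) (y j)) \<longlonglongrightarrow> cinner (blinfun_apply a (x j)) (y j)" for j
        by (rule weak_tendsto [OF c a lim])
    qed simp
    from topological_tendstoD [OF this U] have "\<forall>\<^sub>F n in sequentially. (\<Sum>j. cinner (blinfun_apply (c n) (x j)) (y j)) \<in> U"
      using Basis.prems by (simp add: S)
    then show ?case
      by (rule eventually_mono) (simp add: S c(1))
  qed
qed

text \<open>The predual is defined by ultraweak continuity, so the preimage of a ball is an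
  ultraweak neighbourhood of \<open>a\<close> and no series representation of \<open>f\<close>
  enters.\<close>

lemma predual_eventually:
  fixes c :: "nat \<Rightarrow> 'h \<Rightarrow>\<^sub>L 'h"
  assumes c: "\<And>n. c n \<in> BH" "\<And>n. norm (c n) \<le> M" and a: "a \<in> BH"
    and lim: "\<And>m k. (\<lambda>n. mcoeff e (c n) m k) \<longlonglongrightarrow> mcoeff e a m k"
    and f: "f \<in> predual" and "\<epsilon> > 0"
  shows "\<forall>\<^sub>F n in sequentially. cmod (f (c n) - f a) < \<epsilon>"
proof -
  have "continuous_map ultraweak_topology euclidean f"
    using f by (simp add: predual_def)
  then have "openin ultraweak_topology {b \<in> topspace ultraweak_topology. f b \<in> ball (f a) \<epsilon>}"
    by (rule openin_continuous_map_preimage) simp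
  then have "\<forall>\<^sub>F n in sequentially. c n \<in> {b \<in> topspace ultraweak_topology. f b \<in> ball (f a) \<epsilon>}"
    by (rule ultraweak_eventually [OF c lim]) (use a \<open>\<epsilon> > 0\<close> in simp)
  then show ?thesis
    by (rule eventually_mono) (simp add: dist_norm norm_minus_commute)
qed

lemma permutes_lessThan_FS: "p permutes {..<n} \<Longrightarrow> p \<in> FS"
  unfolding FS_def
proof (intro CollectI conjI)
  assume p: "p permutes {..<n}"
  then have "{k. p k \<noteq> k} \<subseteq> {..<n}"
    using permutes_not_in by fastforce
  then show "finite {k. p k \<noteq> k}"
    by (rule finite_subset) simp
qed (rule permutes_bij)

text \<open>Outside the leading block \<open>c\<close> contains whatever the dilation put there, and
  the identity from index \<open>2 * N\<close> on. This does not disturb entrywise convergence, as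
  every fixed position eventually lies in the block.\<close>

lemma DSS_truncation:
  assumes "a \<in> DSS e"
  obtains c where "c \<in> convex hull (std_rep e ` FS)"
    "\<forall>m<N. \<forall>k<N. mcoeff e c m k = mcoeff e a m k"
proof -
  define A where "A m k = Re (mcoeff e a m k)" for m k
  have A: "substochastic A"
    using assms by (simp add: DSS_iff A_def [abs_def])
  obtain w where w: "\<And>p. 0 \<le> w p" "(\<Sum>p | p permutes {..<2 * N}. w p) = 1"
    "\<And>i j. i < N \<Longrightarrow> j < N \<Longrightarrow>
       A i j = (\<Sum>p | p permutes {..<2 * N}. w p * (if p j = i then 1 else 0))"
    by (rule substochastic_permutation_mixture [of A N]) (use A in \<open>auto simp: substochastic_def\<close>)
  define c where "c = (\<Sum>p | p permutes {..<2 * N}. w p *\<^sub>R std_rep e p)"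
  show ?thesis
  proof
    show "c \<in> convex hull (std_rep e ` FS)"
      unfolding c_def
    proof (rule convex_sum)
      show "std_rep e p \<in> convex hull (std_rep e ` FS)" if "p \<in> {p. p permutes {..<2 * N}}" for p
        using that by (intro hull_inc imageI permutes_lessThan_FS) simp
    qed (use w in \<open>simp_all add: finite_permutations\<close>)
    show "\<forall>m<N. \<forall>k<N. mcoeff e c m k = mcoeff e a m k"
    proof (intro allI impI)
      fix m k assume "m < N" "k < N"
      have "mcoeff e c m k = (\<Sum>p | p permutes {..<2 * N}. of_real (w p * (if p k = m then 1 else 0)))"
        unfolding c_def mcoeff_sum
        by (intro sum.cong refl) (simp add: mcoeff_scaleR mcoeff_std_rep permutes_bij)
      also have "\<dots> = of_real (A m k)"
        using w(3) [OF \<open>m < N\<close> \<open>k < N\<close>] by simp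
      also have "\<dots> = mcoeff e a m k"
        using assms by (simp add: A_def DSS_iff complex_eq_iff)
      finally show "mcoeff e c m k = mcoeff e a m k" .
    qed
  qed
qed

text \<open>\<open>DSS e\<close> is cut out of \<open>BH\<close> by inequalities
  \<open>0 \<le> h b\<close> with \<open>h\<close> continuous, each involving finitely many
  coefficients; such an inequality passes from the hull to its closure.\<close>

lemma closure_subset_DSS: "arens_mackey_topology closure_of (convex hull (std_rep e ` FS)) \<subseteq> DSS e"
proof
  let ?C = "convex hull (std_rep e ` FS)"
  let ?X = "arens_mackey_topology :: ('h \<Rightarrow>\<^sub>L 'h) topology"
  fix a assume a: "a \<in> ?X closure_of ?C"
  have sub: "?C \<subseteq> DSS e"
    by (rule hull_minimal) (auto simp: convex_DSS std_rep_in_DSS FS_def)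
  have top: "topspace ?X = BH"
    by (simp add: arens_mackey_topology_def)
  then have "a \<in> BH"
    using a by (simp add: in_closure_of)
  have nonneg: "0 \<le> h a" if h: "continuous_map ?X euclideanreal h" "\<And>b. b \<in> DSS e \<Longrightarrow> 0 \<le> h b" for h
  proof -
    have "closedin ?X {b \<in> topspace ?X. h b \<in> {0..}}"
      by (rule closedin_continuous_map_preimage [OF h(1)]) simp
    moreover have "?C \<subseteq> {b \<in> topspace ?X. h b \<in> {0..}}"
      using sub h(2) by (auto simp: top DSS_iff)
    ultimately have "?X closure_of ?C \<subseteq> {b \<in> topspace ?X. h b \<in> {0..}}"
      by (rule closure_of_minimal [rotated])
    then show ?thesis
      using a by auto
  qed
  have coeff: "continuous_map ?X euclidean (\<lambda>b. mcoeff e b m k)" for m k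
  proof -
    \<comment> \<open>Members of the predual are extensional, so the coefficient is first restricted
      to \<open>BH\<close>; its continuity is carried back at the end, the two maps being equal on
      the whole space.\<close>
    let ?f = "\<lambda>b\<in>BH. mcoeff e b m k"
    have "continuous_map ultraweak_topology euclidean ?f"
      unfolding continuous_map
    proof (intro conjI allI impI)
      fix U :: "complex set" assume "openin euclidean U"
      \<comment> \<open>A single coefficient is an ultraweak series with only one nonzero
        term.\<close>
      define x where "x n = (if n = 0 then e k else 0)" for n :: nat
      define y where "y n = (if n = 0 then e m else 0)" for n :: nat
      have "(\<lambda>n. cinner (blinfun_apply b (x n)) (y n)) = (\<lambda>n. if n = 0 then mcoeff e b m k else 0)" for b
        by (auto simp: x_def y_def mcoeff_def)
      then have "(\<Sum>n. cinner (blinfun_apply b (x n)) (y n)) = mcoeff e b m k" for b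
        using sums_single [of 0 "\<lambda>_. mcoeff e b m k"] by (simp add: sums_iff)
      then have eq: "{b \<in> topspace ultraweak_topology. ?f b \<in> U}
          = {b \<in> BH. (\<Sum>n. cinner (blinfun_apply b (x n)) (y n)) \<in> U}"
        by auto
      have "summable (\<lambda>n. (norm (x n))\<^sup>2)" "summable (\<lambda>n. (norm (y n))\<^sup>2)"
        by (rule summable_finite [of "{0}"]; simp add: x_def y_def)+
      then show "openin ultraweak_topology {b \<in> topspace ultraweak_topology. ?f b \<in> U}"
        using \<open>openin euclidean U\<close> unfolding eq unfolding ultraweak_topology_def
        by (intro topology_generated_by_Basis CollectI exI [of _ x] exI [of _ y] exI [of _ U] conjI refl) simp_all
    qed simp
    then have "?f \<in> predual"
      by (simp add: predual_def mcoeff_add mcoeff_def scaleC_op.rep_eq cinner_scaleC_left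
          subspace_add [OF subspace_BH] BH_def blinfun.add_left cinner_add_left scaleC_add_right
          scaleC_scaleC mult.commute)
    then have "continuous_map ?X euclidean ?f"
      unfolding arens_mackey_topology_def by (rule continuous_map_mackey_functional) simp
    then show ?thesis
      by (rule continuous_map_eq) (simp add: top)
  qed
  have Re: "continuous_map ?X euclideanreal (\<lambda>b. Re (mcoeff e b m k))"
    and Im: "continuous_map ?X euclideanreal (\<lambda>b. Im (mcoeff e b m k))" for m k
    using continuous_map_compose [OF coeff [of m k], of euclideanreal Re]
      continuous_map_compose [OF coeff [of m k], of euclideanreal Im]
    by (simp_all add: o_def continuous_on_Re continuous_on_Im)
  have "0 \<le> Im (mcoeff e a m k)" "0 \<le> - Im (mcoeff e a m k)" for m k
    by (rule nonneg; use Im in \<open>simp add: DSS_iff\<close>)+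
  moreover have "0 \<le> Re (mcoeff e a m k)" for m k
    by (rule nonneg [OF Re]) (simp add: DSS_iff substochastic_def)
  moreover have "0 \<le> 1 - (\<Sum>k<n. Re (mcoeff e a m k))" for m n
    by (rule nonneg, intro continuous_map_diff continuous_map_sum Re)
      (simp_all add: DSS_iff substochastic_def)
  moreover have "0 \<le> 1 - (\<Sum>m<n. Re (mcoeff e a m k))" for k n
    by (rule nonneg, intro continuous_map_diff continuous_map_sum Re)
      (simp_all add: DSS_iff substochastic_def)
  ultimately show "a \<in> DSS e"
    using \<open>a \<in> BH\<close> by (simp add: DSS_iff substochastic_def order.antisym)
qed

lemma DSS_subset_closure: "DSS e \<subseteq> arens_mackey_topology closure_of (convex hull (std_rep e ` FS))"
proof
  let ?C = "convex hull (std_rep e ` FS)"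
  fix a assume a: "a \<in> DSS e"
  have sub: "?C \<subseteq> BH"
  proof (rule hull_minimal)
    show "std_rep e ` FS \<subseteq> BH"
      using std_rep(1) [OF onb] by (auto simp: FS_def)
  qed (rule subspace_imp_convex [OF subspace_BH])
  \<comment> \<open>The unit ball is convex and contains the permutation operators, which gives the
    bound uniform in \<open>N\<close> that ultraweak convergence needs.\<close>
  have norm: "norm c \<le> 1" if "c \<in> ?C" for c
  proof -
    have "?C \<subseteq> cball 0 1"
      using std_rep(3) [OF onb] by (intro hull_minimal) (auto simp: FS_def)
    then show ?thesis using that by auto
  qed
  have "\<forall>N. \<exists>c. c \<in> ?C \<and> (\<forall>m<N. \<forall>k<N. mcoeff e c m k = mcoeff e a m k)"
    using DSS_truncation [OF a] by blast
  from choice [OF this] obtain c where "\<forall>N. c N \<in> ?C \<and> (\<forall>m<N. \<forall>k<N. mcoeff e (c N) m k = mcoeff e a m k)"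
    by blast
  then have c: "c N \<in> ?C" "m < N \<Longrightarrow> k < N \<Longrightarrow> mcoeff e (c N) m k = mcoeff e a m k" for N m k
    by blast+
  have lim: "(\<lambda>N. mcoeff e (c N) m k) \<longlonglongrightarrow> mcoeff e a m k" for m k
  proof (rule tendsto_eventually)
    show "\<forall>\<^sub>F N in sequentially. mcoeff e (c N) m k = mcoeff e a m k"
      unfolding eventually_sequentially
      by (intro exI [of _ "Suc (max m k)"] allI impI c(2)) auto
  qed
  show "a \<in> arens_mackey_topology closure_of ?C"
    unfolding arens_mackey_topology_def
  proof (rule mackey_closure_of_convex [OF sub])
    show "a \<in> BH"
      using a by (simp add: DSS_iff)
    show "f (u *\<^sub>R c + v *\<^sub>R d) = of_real u * f c + of_real v * f d"
      if "f \<in> predual" "c \<in> ?C" "d \<in> ?C" for f c d u v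
      using that sub by (intro predual_real_linear) blast+
    show "\<exists>c\<in>?C. \<forall>f\<in>G. cmod (f c - f a) < \<epsilon>" if "finite G" "G \<subseteq> predual" "0 < \<epsilon>" for G \<epsilon>
    proof -
      have "\<forall>\<^sub>F N in sequentially. cmod (f (c N) - f a) < \<epsilon>" if "f \<in> G" for f
      proof (rule predual_eventually [where M = 1 and f = f and c = c and a = a])
        show "c N \<in> BH" "norm (c N) \<le> 1" for N
          using c(1) [of N] sub norm by blast+
      show "a \<in> BH"
          using a by (simp add: DSS_iff)
        show "f \<in> predual"
          using that \<open>G \<subseteq> predual\<close> by blast
      qed (rule lim \<open>0 < \<epsilon>\<close>)+
      then have "\<forall>\<^sub>F N in sequentially. \<forall>f\<in>G. cmod (f (c N) - f a) < \<epsilon>"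
        by (intro eventually_ball_finite \<open>finite G\<close> ballI)
      from eventually_happens' [OF sequentially_bot this]
      obtain N where "\<forall>f\<in>G. cmod (f (c N) - f a) < \<epsilon>"
        by blast
      then show ?thesis
        using c(1) by blast
    qed
  qed (rule convex_convex_hull)
qed

end

section \<open>Extreme points\<close>

text \<open>Read \<open>w\<close> as a probability distribution on permutations. Then
  \<open>A m k\<close> is the probability that \<open>p k = m\<close>, and \<open>B\<close> is the
  expected permutation matrix conditioned on this event. The complementary event has mass
  \<open>1 - A m k\<close>, which bounds the line sums of the remainder. The comparison is confined
  to the leading block, where the mixture reproduces \<open>A\<close>.\<close>

lemma conditioned_mixture:
  assumes A: "substochastic A" and t: "0 < A m k" and mk: "m < N" "k < N"
  obtains B where "substochastic B" "B m k = 1"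
    "\<forall>i<N. \<forall>j<N. A m k * B i j \<le> A i j"
    "\<forall>i<N. \<forall>n\<le>N. (\<Sum>j<n. A i j - A m k * B i j) \<le> 1 - A m k"
    "\<forall>j<N. \<forall>n\<le>N. (\<Sum>i<n. A i j - A m k * B i j) \<le> 1 - A m k"
proof -
  define P where "P = {p. p permutes {..<2 * N}}"
  obtain w where w: "\<And>p. 0 \<le> w p" "(\<Sum>p\<in>P. w p) = 1"
    "\<And>i j. i < N \<Longrightarrow> j < N \<Longrightarrow> A i j = (\<Sum>p\<in>P. w p * (if p j = i then 1 else 0))"
    unfolding P_def
    by (rule substochastic_permutation_mixture [of A N]) (use A in \<open>auto simp: substochastic_def\<close>)
  \<comment> \<open>\<open>v True\<close> is the part of \<open>w\<close> on the permutations with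
    \<open>p k = m\<close> and \<open>v False\<close> the rest; \<open>D q\<close> is the matrix of
    the unnormalized part \<open>v q\<close>.\<close>
  define v where "v q p = (if (p k = m) = q then w p else 0)" for q p
  define D where "D q i j = (\<Sum>p\<in>P. v q p * (if p j = i then 1 else 0))" for q i j
  have v: "0 \<le> v q p" for q p
    using w(1) by (simp add: v_def)
  have v_split: "w p = v True p + v False p" for p
    by (simp add: v_def)
  have True_sum: "(\<Sum>p\<in>P. v True p) = A m k"
    unfolding w(3) [OF mk] by (intro sum.cong) (auto simp: v_def)
  have False_sum: "(\<Sum>p\<in>P. v False p) = 1 - A m k"
    using w(2) True_sum by (simp add: v_split sum.distrib)
  have A_eq: "A i j = D True i j + D False i j" if "i < N" "j < N" for i j
    unfolding w(3) [OF that] D_def v_split distrib_right sum.distrib ..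
  have D_nonneg: "0 \<le> D q i j" for q i j
    unfolding D_def using v by (intro sum_nonneg) simp
  have row: "(\<Sum>j<n. D q i j) \<le> (\<Sum>p\<in>P. v q p)" for q i n
  proof -
    have "(\<Sum>j<n. D q i j) = (\<Sum>p\<in>P. v q p * (\<Sum>j<n. if p j = i then 1 else 0))"
      unfolding D_def by (subst sum.swap) (simp only: sum_distrib_left)
    also have "\<dots> \<le> (\<Sum>p\<in>P. v q p * 1)"
    proof (intro sum_mono mult_left_mono v)
      fix p assume "p \<in> P"
      then have "p permutes {..<2 * N}" by (simp add: P_def)
      then have "(\<Sum>j<n. if p j = i then 1 else 0 :: real) = (\<Sum>j<n. if j = inv p i then 1 else 0)"
        by (intro sum.cong if_cong refl) (metis permutes_inv_eq)
      then show "(\<Sum>j<n. if p j = i then 1 else 0 :: real) \<le> 1" by simp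
    qed
    finally show ?thesis by simp
  qed
  have col: "(\<Sum>i<n. D q i j) \<le> (\<Sum>p\<in>P. v q p)" for q j n
  proof -
    have "(\<Sum>i<n. D q i j) = (\<Sum>p\<in>P. v q p * (\<Sum>i<n. if p j = i then 1 else 0))"
      unfolding D_def by (subst sum.swap) (simp only: sum_distrib_left)
    also have "\<dots> \<le> (\<Sum>p\<in>P. v q p * 1)"
      by (intro sum_mono mult_left_mono v) simp
    finally show ?thesis by simp
  qed
  define B where "B i j = D True i j / A m k" for i j
  have AB: "A i j - A m k * B i j = D False i j" if "i < N" "j < N" for i j
    using t by (simp add: B_def A_eq [OF that])
  show ?thesis
  proof
    show "substochastic B"
      using D_nonneg row [of True] col [of True] t
      by (simp add: substochastic_def B_def True_sum flip: sum_divide_distrib)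
    have "D True m k = (\<Sum>p\<in>P. v True p)"
      unfolding D_def by (intro sum.cong) (auto simp: v_def)
    then show "B m k = 1"
      using t by (simp add: B_def True_sum)
    show "\<forall>i<N. \<forall>j<N. A m k * B i j \<le> A i j"
    proof (intro allI impI)
      fix i j assume "i < N" "j < N"
      then show "A m k * B i j \<le> A i j"
        using AB [of i j] D_nonneg [of False i j] by simp
    qed
    show "\<forall>i<N. \<forall>n\<le>N. (\<Sum>j<n. A i j - A m k * B i j) \<le> 1 - A m k"
    proof (intro allI impI)
      fix i n assume "i < N" "n \<le> N"
      then have "(\<Sum>j<n. A i j - A m k * B i j) = (\<Sum>j<n. D False i j)"
        by (intro sum.cong) (simp_all add: AB)
      then show "(\<Sum>j<n. A i j - A m k * B i j) \<le> 1 - A m k"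
        using row [of False i n] by (simp add: False_sum)
    qed
    show "\<forall>j<N. \<forall>n\<le>N. (\<Sum>i<n. A i j - A m k * B i j) \<le> 1 - A m k"
    proof (intro allI impI)
      fix j n assume "j < N" "n \<le> N"
      then have "(\<Sum>i<n. A i j - A m k * B i j) = (\<Sum>i<n. D False i j)"
        by (intro sum.cong) (simp_all add: AB)
      then show "(\<Sum>i<n. A i j - A m k * B i j) \<le> 1 - A m k"
        using col [of False j n] by (simp add: False_sum)
    qed
  qed
qed

text \<open>Uncurried, the matrices are points of a product of unit intervals over the countable set
  of index pairs: compact by Tychonoff and metrizable, hence sequentially compact.\<close>

lemma entrywise_convergent_subsequence:
  fixes B :: "nat \<Rightarrow> nat \<Rightarrow> nat \<Rightarrow> real"
  assumes "\<And>n i j. 0 \<le> B n i j" "\<And>n i j. B n i j \<le> 1"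
  obtains r B' where "strict_mono (r :: nat \<Rightarrow> nat)" "\<And>i j. (\<lambda>n. B (r n) i j) \<longlonglongrightarrow> B' i j"
proof -
  define f where "f n p = B n (fst p) (snd p)" for n p
  have "compactin (product_topology (\<lambda>_. euclideanreal) UNIV) (UNIV \<rightarrow>\<^sub>E {0..1} :: (nat \<times> nat \<Rightarrow> real) set)"
    unfolding compactin_PiE by simp
  then have "compact (UNIV \<rightarrow>\<^sub>E {0..1} :: (nat \<times> nat \<Rightarrow> real) set)"
    by (simp only: euclidean_product_topology compactin_euclidean_iff)
  then have "seq_compact (UNIV \<rightarrow>\<^sub>E {0..1} :: (nat \<times> nat \<Rightarrow> real) set)"
    by (simp only: compact_eq_seq_compact_metric)
  moreover have "f n \<in> UNIV \<rightarrow>\<^sub>E {0..1}" for n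
    using assms by (auto simp: f_def)
  ultimately obtain l r where r: "strict_mono r" "(f \<circ> r) \<longlonglongrightarrow> l"
    using seq_compactE by blast
  have "(\<lambda>n. (f \<circ> r) n p) \<longlonglongrightarrow> l p" for p
    by (rule continuous_on_tendsto_compose [OF continuous_on_product_coordinates r(2)]) simp_all
  from this [of "(_, _)"] have "(\<lambda>n. B (r n) i j) \<longlonglongrightarrow> l (i, j)" for i j
    by (simp add: f_def)
  then show ?thesis
    by (rule that [OF r(1), of "\<lambda>i j. l (i, j)"])
qed

text \<open>The conditioned matrices of growing blocks have an entrywise limit \<open>B'\<close>,
  and the finitary inequalities in \<open>good\<close> survive the limit. At \<open>(m, k)\<close>
  the limit has entry 1 and the complementary matrix \<open>C\<close> has entry 0, so the two
  differ.\<close>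

lemma substochastic_split:
  assumes A: "substochastic A" and t: "0 < A m k" "A m k < 1"
  obtains B C where "substochastic B" "substochastic C" "B m k \<noteq> C m k"
    "\<forall>i j. A i j = A m k * B i j + (1 - A m k) * C i j"
proof -
  define t where "t = A m k"
  have t01: "0 < t" "t < 1"
    using t by (simp_all add: t_def)
  define good where "good n B \<longleftrightarrow> substochastic B \<and> B m k = 1 \<and>
      (\<forall>i<n. \<forall>j<n. t * B i j \<le> A i j) \<and>
      (\<forall>i<n. \<forall>l\<le>n. (\<Sum>j<l. A i j - t * B i j) \<le> 1 - t) \<and>
      (\<forall>j<n. \<forall>l\<le>n. (\<Sum>i<l. A i j - t * B i j) \<le> 1 - t)" for n B
  have "\<exists>B. good n B" for n
  proof -
    \<comment> \<open>The block has to contain the position \<open>(m, k)\<close> even for small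
      \<open>n\<close>.\<close>
    define N where "N = Suc (max n (max m k))"
    have N: "m < N" "k < N" "n \<le> N"
      by (auto simp: N_def)
    obtain B where B: "substochastic B" "B m k = 1"
      "\<forall>i<N. \<forall>j<N. t * B i j \<le> A i j"
      "\<forall>i<N. \<forall>l\<le>N. (\<Sum>j<l. A i j - t * B i j) \<le> 1 - t"
      "\<forall>j<N. \<forall>l\<le>N. (\<Sum>i<l. A i j - t * B i j) \<le> 1 - t"
      unfolding t_def by (rule conditioned_mixture [OF A t(1) N(1,2)])
    have "good n B"
      unfolding good_def
    proof (intro conjI allI impI B(1,2))
      show "t * B i j \<le> A i j" if "i < n" "j < n" for i j
        using that N(3) by (intro B(3) [rule_format]) simp_all
      show "(\<Sum>j<l. A i j - t * B i j) \<le> 1 - t" if "i < n" "l \<le> n" for i l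
        using that N(3) by (intro B(4) [rule_format]) simp_all
      show "(\<Sum>i<l. A i j - t * B i j) \<le> 1 - t" if "j < n" "l \<le> n" for j l
        using that N(3) by (intro B(5) [rule_format]) simp_all
    qed
    then show ?thesis by (rule exI [of _ B])
  qed
  then have "\<forall>n. \<exists>B. good n B" by blast
  from choice [OF this] obtain B where good: "\<And>n. good n (B n)" by blast
  have B: "substochastic (B n)" for n
    using good [of n] by (simp add: good_def)
  obtain r B' where r: "strict_mono (r :: nat \<Rightarrow> nat)"
    and lim: "\<And>i j. (\<lambda>n. B (r n) i j) \<longlonglongrightarrow> B' i j"
  proof (rule entrywise_convergent_subsequence [of B])
    show "0 \<le> B n i j" "B n i j \<le> 1" for n i j
      using B [of n] substochastic_le_1 [OF B] by (auto simp: substochastic_def)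
  qed (rule that)
  \<comment> \<open>Ensures that any fixed range of indices is eventually covered by the bounds that
    \<open>good (r n)\<close> provides.\<close>
  have rn: "n \<le> r n" for n
    by (rule seq_suble [OF r])
  have B': "substochastic B'"
    unfolding substochastic_def
  proof (intro conjI allI)
    show "0 \<le> B' i j" for i j
      using B by (intro LIMSEQ_le_const [OF lim]) (simp add: substochastic_def)
    show "(\<Sum>j<l. B' i j) \<le> 1" for i l
    proof (rule LIMSEQ_le_const2)
      show "(\<lambda>n. \<Sum>j<l. B (r n) i j) \<longlonglongrightarrow> (\<Sum>j<l. B' i j)"
        by (intro tendsto_sum lim)
    qed (use B in \<open>simp add: substochastic_def\<close>)
    show "(\<Sum>i<l. B' i j) \<le> 1" for j l
    proof (rule LIMSEQ_le_const2)
      show "(\<lambda>n. \<Sum>i<l. B (r n) i j) \<longlonglongrightarrow> (\<Sum>i<l. B' i j)"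
        by (intro tendsto_sum lim)
    qed (use B in \<open>simp add: substochastic_def\<close>)
  qed
  have "(\<lambda>n. B (r n) m k) = (\<lambda>n. 1)"
    using good by (simp add: good_def)
  then have B'mk: "B' m k = 1"
    using lim [of m k] by (simp add: LIMSEQ_const_iff)
  \<comment> \<open>The decomposition of \<open>A\<close> with weights \<open>t\<close> and
    \<open>1 - t\<close> forces this formula; the remainder has line sums at most
    \<open>1 - t\<close>, which the division turns into 1.\<close>
  define C where "C i j = (A i j - t * B' i j) / (1 - t)" for i j
  have C: "substochastic C"
    unfolding substochastic_def
  proof (intro conjI allI)
    show "0 \<le> C i j" for i j
    proof -
      have "t * B' i j \<le> A i j"
      proof (rule LIMSEQ_le_const2)
        show "(\<lambda>n. t * B (r n) i j) \<longlonglongrightarrow> t * B' i j"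
          by (intro tendsto_intros lim)
        have "t * B (r n) i j \<le> A i j" if "n \<ge> Suc (max i j)" for n
        proof -
          have "i < r n" "j < r n"
            using that rn [of n] by auto
          then show ?thesis
            using good [of "r n"] unfolding good_def by blast
        qed
        then show "\<exists>N. \<forall>n\<ge>N. t * B (r n) i j \<le> A i j" by blast
      qed
      then show ?thesis
        using t01 by (simp add: C_def)
    qed
    show "(\<Sum>j<l. C i j) \<le> 1" for i l
    proof -
      have "(\<Sum>j<l. A i j - t * B' i j) \<le> 1 - t"
      proof (rule LIMSEQ_le_const2)
        show "(\<lambda>n. \<Sum>j<l. A i j - t * B (r n) i j) \<longlonglongrightarrow> (\<Sum>j<l. A i j - t * B' i j)"
          by (intro tendsto_intros lim)
        have "(\<Sum>j<l. A i j - t * B (r n) i j) \<le> 1 - t" if "n \<ge> Suc (max i l)" for n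
        proof -
          have "i < r n" "l \<le> r n"
            using that rn [of n] by auto
          then show ?thesis
            using good [of "r n"] unfolding good_def by blast
        qed
        then show "\<exists>N. \<forall>n\<ge>N. (\<Sum>j<l. A i j - t * B (r n) i j) \<le> 1 - t" by blast
      qed
      then show ?thesis
        using t01 by (simp add: C_def flip: sum_divide_distrib)
    qed
    show "(\<Sum>i<l. C i j) \<le> 1" for j l
    proof -
      have "(\<Sum>i<l. A i j - t * B' i j) \<le> 1 - t"
      proof (rule LIMSEQ_le_const2)
        show "(\<lambda>n. \<Sum>i<l. A i j - t * B (r n) i j) \<longlonglongrightarrow> (\<Sum>i<l. A i j - t * B' i j)"
          by (intro tendsto_intros lim)
        have "(\<Sum>i<l. A i j - t * B (r n) i j) \<le> 1 - t" if "n \<ge> Suc (max j l)" for n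
        proof -
          have "j < r n" "l \<le> r n"
            using that rn [of n] by auto
          then show ?thesis
            using good [of "r n"] unfolding good_def by blast
        qed
        then show "\<exists>N. \<forall>n\<ge>N. (\<Sum>i<l. A i j - t * B (r n) i j) \<le> 1 - t" by blast
      qed
      then show ?thesis
        using t01 by (simp add: C_def flip: sum_divide_distrib)
    qed
  qed
  show ?thesis
  proof (rule that [OF B' C])
    show "B' m k \<noteq> C m k"
      by (simp add: B'mk C_def t_def)
    show "\<forall>i j. A i j = A m k * B' i j + (1 - A m k) * C i j"
      using t01 by (simp add: C_def flip: t_def)
  qed
qed

context
  fixes e :: "nat \<Rightarrow> 'h :: chilbert_space"
  assumes onb: "orthonormal_basis e"
begin

lemma DSS_of_substochastic:
  assumes "substochastic B"
  shows "\<exists>b\<in>DSS e. \<forall>m k. mcoeff e b m k = of_real (B m k)"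
proof (rule substochastic_operator [OF onb, of B])
  fix b assume "b \<in> BH" "\<And>m k. mcoeff e b m k = complex_of_real (B m k)"
  then show ?thesis
    using assms by (intro bexI [of _ b]) (simp_all add: DSS_iff)
qed (use assms in \<open>auto simp: substochastic_def\<close>)

lemma extreme_DSS_subset: "a extreme_point_of DSS e \<Longrightarrow> a \<in> PS e"
proof -
  assume a: "a extreme_point_of DSS e"
  then have aD: "a \<in> DSS e"
    by (simp add: extreme_point_of_def)
  define A where "A m k = Re (mcoeff e a m k)" for m k
  have A: "substochastic A"
    using aD by (simp add: DSS_iff A_def [abs_def])
  have mcoeff_a: "mcoeff e a m k = of_real (A m k)" for m k
    using aD by (simp add: A_def DSS_iff complex_eq_iff)
  have "A m k = 0 \<or> A m k = 1" for m k
  proof (rule ccontr)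
    assume "\<not> (A m k = 0 \<or> A m k = 1)"
    moreover have "0 \<le> A m k" "A m k \<le> 1"
      using A substochastic_le_1 [OF A] by (simp_all add: substochastic_def)
    ultimately have t: "0 < A m k" "A m k < 1"
      by simp_all
    obtain B C where BC: "substochastic B" "substochastic C" "B m k \<noteq> C m k"
      "\<forall>i j. A i j = A m k * B i j + (1 - A m k) * C i j"
      by (rule substochastic_split [OF A t])
    obtain b where b: "b \<in> DSS e" "\<forall>i j. mcoeff e b i j = of_real (B i j)"
      using DSS_of_substochastic [OF BC(1)] by blast
    obtain c where c: "c \<in> DSS e" "\<forall>i j. mcoeff e c i j = of_real (C i j)"
      using DSS_of_substochastic [OF BC(2)] by blast
    have "c \<in> BH" "b \<in> BH"
      using b(1) c(1) by (simp_all add: DSS_iff)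
    have "a \<in> open_segment c b"
      unfolding in_segment
    proof (intro conjI exI)
      show "c \<noteq> b"
      proof -
        have "mcoeff e c m k \<noteq> mcoeff e b m k"
          using BC(3) by (simp add: b(2) c(2))
        then show ?thesis by blast
      qed
      show "0 < A m k" "A m k < 1" by fact+
      show "a = (1 - A m k) *\<^sub>R c + A m k *\<^sub>R b"
      proof (rule BH_eqI [OF onb])
        show "(1 - A m k) *\<^sub>R c + A m k *\<^sub>R b \<in> BH"
          using \<open>c \<in> BH\<close> \<open>b \<in> BH\<close>
          by (intro subspace_add [OF subspace_BH] subspace_scale [OF subspace_BH])
        show "mcoeff e a i j = mcoeff e ((1 - A m k) *\<^sub>R c + A m k *\<^sub>R b) i j" for i j
        proof -
          have "A i j = (1 - A m k) * C i j + A m k * B i j"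
            by (subst add.commute) (rule BC(4) [rule_format])
          then show ?thesis
            unfolding mcoeff_a mcoeff_add mcoeff_scaleR by (simp only: b(2) c(2) of_real_add of_real_mult)
        qed
      qed (use aD in \<open>simp add: DSS_iff\<close>)
    qed
    then show False
      using a b(1) c(1) by (simp add: extreme_point_of_def)
  qed
  then show "a \<in> PS e"
    using aD by (auto simp: PS_def DSS_def mcoeff_a)
qed

text \<open>Entries of elements of \<open>DSS e\<close> lie in the unit interval, of which 0 and 1
  are extreme points. Hence both ends of a segment through \<open>a\<close> have the same entries as
  each other, and entries determine the operator.\<close>

lemma PS_subset_extreme: "a \<in> PS e \<Longrightarrow> a extreme_point_of DSS e"
  unfolding extreme_point_of_def
proof (intro conjI ballI notI)
  assume a: "a \<in> PS e"
  have a01: "mcoeff e a m k = 0 \<or> mcoeff e a m k = 1" for m k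
    using a by (auto simp: PS_def)
  have "mcoeff e a m k \<in> \<real>\<^sub>\<ge>\<^sub>0" for m k
    using a01 [of m k] by (auto simp: complex_nonneg_Reals_iff)
  then show "a \<in> DSS e"
    using a by (simp add: PS_def DSS_def)
  fix b c assume b: "b \<in> DSS e" and c: "c \<in> DSS e" and "a \<in> open_segment b c"
  then obtain u where u: "0 < u" "u < 1" "a = (1 - u) *\<^sub>R b + u *\<^sub>R c" "b \<noteq> c"
    by (auto simp: in_segment)
  have entry: "x = y" if x: "0 \<le> x" "x \<le> 1" and y: "0 \<le> y" "y \<le> 1"
    and xy: "(1 - u) * x + u * y = 0 \<or> (1 - u) * x + u * y = 1" for x y
    using xy
  proof
    assume "(1 - u) * x + u * y = 0"
    moreover have "0 \<le> (1 - u) * x" "0 \<le> u * y"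
      using u x y by simp_all
    ultimately have "(1 - u) * x = 0" "u * y = 0"
      by linarith+
    then show ?thesis using u by simp
  next
    assume "(1 - u) * x + u * y = 1"
    then have "(1 - u) * (1 - x) + u * (1 - y) = 0"
      by (simp add: algebra_simps)
    moreover have "0 \<le> (1 - u) * (1 - x)" "0 \<le> u * (1 - y)"
      using u x y by simp_all
    ultimately have "(1 - u) * (1 - x) = 0" "u * (1 - y) = 0"
      by linarith+
    then show ?thesis using u by simp
  qed
  have "mcoeff e b m k = mcoeff e c m k" for m k
  proof -
    have range: "0 \<le> Re (mcoeff e d m k)" "Re (mcoeff e d m k) \<le> 1" "Im (mcoeff e d m k) = 0"
      if "d \<in> DSS e" for d
      using that substochastic_le_1 [of "\<lambda>m k. Re (mcoeff e d m k)" m k]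
      by (simp_all add: DSS_iff substochastic_def)
    have "Re (mcoeff e a m k) = (1 - u) * Re (mcoeff e b m k) + u * Re (mcoeff e c m k)"
      unfolding u(3) mcoeff_add mcoeff_scaleR by simp
    then have "Re (mcoeff e b m k) = Re (mcoeff e c m k)"
      using a01 [of m k] range [OF b] range [OF c] by (intro entry) auto
    then show ?thesis
      using range(3) [OF b] range(3) [OF c] by (simp add: complex_eq_iff)
  qed
  then have "b = c"
    using b c by (intro BH_eqI [OF onb]) (simp_all add: DSS_iff)
  then show False
    using u(4) by contradiction
qed

end

theorem theorem2p14:
  fixes e :: "nat \<Rightarrow> 'h :: chilbert_space"
  assumes "orthonormal_basis e"
  shows "arens_mackey_topology closure_of (convex hull (std_rep e ` FS)) = DSS e \<and>
         {a. a extreme_point_of DSS e} = PS e"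
  using closure_subset_DSS [OF assms] DSS_subset_closure [OF assms] extreme_DSS_subset [OF assms]
    PS_subset_extreme [OF assms]
  by blast

end
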